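(* There exists an oracle $D$ such that $\#\mathrm{P}_1^D\subseteq\mathrm{FP}^D\neq\#\mathrm{P}^D$.
   Context: For an oracle $D$: $\#\mathrm{P}^D$ is the class of functions $x\mapsto$ (number of accepting paths of $M^D$ on $x$) for nondeterministic polynomial-time oracle machines $M$; $\#\mathrm{P}_1^D$ is the same with $M$ restricted to a unary input alphabet; $\mathrm{FP}^D$ is the class of functions computable by deterministic polynomial-time oracle transducers with oracle $D$. *)

theory Defs
  imports Main "HOL-Computational_Algebra.Polynomial"
begin

text \<open>
  Nondeterministic multitape oracle Turing machines with two-way infinite tapes. Tape 0 carries the
  input, tape 1 is the query tape and tape 2 the output tape. Oracles are sets of binary words.
\<close>

datatype symbol = Blank | Bit bool | Aux nat

datatype move = MLeft | MStay | MRight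

type_synonym tape = "(int \<Rightarrow> symbol) \<times> int"
type_synonym config = "nat \<times> tape list"
type_synonym transition = "(nat \<times> symbol list) \<times> (nat \<times> (symbol \<times> move) list)"
type_synonym language = "bool list set"

text \<open>
  A transition ((q, r), (q', a)) applies in state q when r lists the symbols scanned on the tapes;
  it leads to state q' and writes and moves as prescribed by a. States are natural numbers; a machine
  uses only finitely many of them because its transition table is finite.
\<close>

record otm =
  tapes :: nat
  transitions :: "transition set"
  start_state :: nat
  accept_state :: nat
  query_state :: nat
  yes_state :: nat
  no_state :: nat

definition wf_otm :: "otm \<Rightarrow> bool" where
  "wf_otm M \<longleftrightarrow> 3 \<le> tapes M \<and> finite (transitions M) \<and>
     (\<forall>((q, r), (q', a)) \<in> transitions M. length r = tapes M \<and> length a = tapes M)"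

definition deterministic :: "otm \<Rightarrow> bool" where
  "deterministic M \<longleftrightarrow>
     (\<forall>l r r'. (l, r) \<in> transitions M \<longrightarrow> (l, r') \<in> transitions M \<longrightarrow> r = r')"

fun scan :: "tape \<Rightarrow> symbol" where
  "scan (t, h) = t h"

fun displacement :: "move \<Rightarrow> int" where
  "displacement MLeft = -1"
| "displacement MStay = 0"
| "displacement MRight = 1"

fun act :: "symbol \<times> move \<Rightarrow> tape \<Rightarrow> tape" where
  "act (s, d) (t, h) = (t(h := s), h + displacement d)"

text \<open>
  The word on a tape extends from cell 0 to the first blank cell to the right; the position of the
  head is irrelevant.
\<close>

definition holds_word :: "tape \<Rightarrow> bool list \<Rightarrow> bool" where
  "holds_word t w \<longleftrightarrow>
     (\<forall>i < length w. fst t (int i) = Bit (w ! i)) \<and> fst t (int (length w)) = Blank"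

text \<open>
  In the query state the machine makes one step to the yes or no state, leaving the tapes unchanged.
  A query tape whose word is not binary is answered negatively.
\<close>

definition step :: "otm \<Rightarrow> language \<Rightarrow> config \<Rightarrow> config \<Rightarrow> bool" where
  "step M D c c' \<longleftrightarrow>
     (if fst c = query_state M
      then c' = (if \<exists>w\<in>D. holds_word (snd c ! 1) w then yes_state M else no_state M, snd c)
      else \<exists>q' a. ((fst c, map scan (snd c)), (q', a)) \<in> transitions M \<and> c' = (q', map2 act a (snd c)))"

definition halted :: "otm \<Rightarrow> language \<Rightarrow> config \<Rightarrow> bool" where
  "halted M D c \<longleftrightarrow> (\<nexists>c'. step M D c c')"

definition input_tape :: "symbol list \<Rightarrow> tape" where
  "input_tape x = ((\<lambda>i. if 0 \<le> i \<and> nat i < length x then x ! nat i else Blank), 0)"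

definition init :: "otm \<Rightarrow> symbol list \<Rightarrow> config" where
  "init M x = (start_state M, input_tape x # replicate (tapes M - 1) (input_tape []))"

text \<open>
  Distinct transitions applicable to the same configuration lead to distinct configurations, so
  computation paths may be identified with their sequences of configurations.
\<close>

definition accepting_paths :: "otm \<Rightarrow> language \<Rightarrow> symbol list \<Rightarrow> config list set" where
  "accepting_paths M D x =
     {cs. cs \<noteq> [] \<and> hd cs = init M x \<and> successively (step M D) cs \<and>
          halted M D (last cs) \<and> fst (last cs) = accept_state M}"

definition poly_time :: "otm \<Rightarrow> language \<Rightarrow> symbol set \<Rightarrow> bool" where
  "poly_time M D \<Sigma> \<longleftrightarrow>
     (\<exists>p :: nat poly. \<forall>x \<in> lists \<Sigma>. \<forall>t c. (step M D ^^ t) (init M x) c \<longrightarrow> t \<le> poly p (length x))"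

definition input_alphabet :: "symbol set \<Rightarrow> bool" where
  "input_alphabet \<Sigma> \<longleftrightarrow> finite \<Sigma> \<and> \<Sigma> \<noteq> {} \<and> Blank \<notin> \<Sigma>"

text \<open>Most significant bit first; leading zeros are allowed and the empty word denotes 0.\<close>

definition binary_value :: "bool list \<Rightarrow> nat" where
  "binary_value w = horner_sum of_bool 2 (rev w)"

definition outputs :: "otm \<Rightarrow> language \<Rightarrow> symbol list \<Rightarrow> nat \<Rightarrow> bool" where
  "outputs M D x n \<longleftrightarrow>
     (\<exists>c w. (step M D)\<^sup>*\<^sup>* (init M x) c \<and> halted M D c \<and>
            holds_word (snd c ! 2) w \<and> binary_value w = n)"

text \<open>
  A function from the words over an input alphabet to the natural numbers is represented by a partial
  map whose domain is the set of these words.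
\<close>

definition sharpP_over :: "symbol set \<Rightarrow> language \<Rightarrow> (symbol list \<rightharpoonup> nat) set" where
  "sharpP_over \<Sigma> D =
     {f. dom f = lists \<Sigma> \<and>
         (\<exists>M. wf_otm M \<and> poly_time M D \<Sigma> \<and>
              (\<forall>x \<in> lists \<Sigma>. f x = Some (card (accepting_paths M D x))))}"

definition FP_over :: "symbol set \<Rightarrow> language \<Rightarrow> (symbol list \<rightharpoonup> nat) set" where
  "FP_over \<Sigma> D =
     {f. dom f = lists \<Sigma> \<and>
         (\<exists>M. wf_otm M \<and> deterministic M \<and> poly_time M D \<Sigma> \<and>
              (\<forall>x \<in> lists \<Sigma>. \<exists>n. f x = Some n \<and> outputs M D x n))}"

definition sharpP :: "language \<Rightarrow> (symbol list \<rightharpoonup> nat) set" where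
  "sharpP D = (\<Union>\<Sigma> \<in> {\<Sigma>. input_alphabet \<Sigma>}. sharpP_over \<Sigma> D)"

definition sharpP1 :: "language \<Rightarrow> (symbol list \<rightharpoonup> nat) set" where
  "sharpP1 D = (\<Union>\<Sigma> \<in> {\<Sigma>. input_alphabet \<Sigma> \<and> card \<Sigma> = 1}. sharpP_over \<Sigma> D)"

definition FP :: "language \<Rightarrow> (symbol list \<rightharpoonup> nat) set" where
  "FP D = (\<Union>\<Sigma> \<in> {\<Sigma>. input_alphabet \<Sigma>}. FP_over \<Sigma> D)"

end

theory Submission
  imports Defs "HOL-Library.Countable_Set"
begin

text \<open>
  From an arbitrary set A of binary words build D(A): words starting with 0 are taken from A, and words
  starting with 1 encode, bit by bit, the numbers of accepting paths of all machines on unary inputs.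
  An encoding word is longer than every query of the computation that it describes, so D(A) is well
  defined by recursion on word length, and every function in #P1 can be read off by a deterministic
  machine.

  The function counting, for a binary word x of length n, the words y of length n such that 0 followed
  by the interleaving of x and y belongs to A is in #P. A deterministic machine with running time t
  sees only polynomially many encoding words, that is, polynomially many bits of advice, but has to
  determine the sizes of exponentially many blocks of exponential size; a counting argument makes it
  fail for a suitable choice of A on words of length 2n + 1. As this only depends on a finite part of
  A, all machines can be defeated one after the other.
\<close>

section \<open>Computations as relations\<close>

lemma holds_word_unique:
  assumes "holds_word t v" "holds_word t w"
  shows "v = w"
proof -
  have "length v' \<le> length w'" if "holds_word t v'" "holds_word t w'" for v' w'
    using that unfolding holds_word_def by (metis not_le symbol.distinct(1))
  then have "length v = length w" using assms by (meson antisym)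
  moreover have "v ! i = w ! i" if "i < length v" for i
    using assms that calculation unfolding holds_word_def by (metis symbol.inject(1))
  ultimately show ?thesis by (rule nth_equalityI)
qed

text \<open>A step writes only the scanned cell and moves the head by at most one, so
  \<open>i\<close> steps can write only cells to the left of cell \<open>i\<close>.\<close>

lemma query_tape_bound:
  assumes "wf_otm M" "(step M D ^^ i) (init M x) c"
  shows "length (snd c) = tapes M \<and> snd (snd c ! 1) \<le> int i \<and>
         (\<forall>z \<ge> int i. fst (snd c ! 1) z = Blank)"
  using assms(2)
proof (induction i arbitrary: c)
  case 0
  have "3 \<le> tapes M" using assms(1) by (simp add: wf_otm_def)
  then show ?case using 0 by (auto simp: init_def input_tape_def nth_Cons split: nat.splits)
next
  case (Suc i)
  from Suc.prems obtain b where b: "(step M D ^^ i) (init M x) b" "step M D b c"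
    by auto
  note IH = Suc.IH[OF b(1)]
  have T: "3 \<le> tapes M" using assms(1) by (simp add: wf_otm_def)
  show ?case
  proof (cases "fst b = query_state M")
    case True
    then show ?thesis using b IH by (auto simp: step_def)
  next
    case False
    then obtain q' a where qa: "((fst b, map scan (snd b)), (q', a)) \<in> transitions M"
        and c: "c = (q', map2 act a (snd b))"
      using b(2) by (auto simp: step_def)
    have la: "length a = tapes M" using qa assms(1) by (fastforce simp: wf_otm_def)
    obtain s d where sd: "a ! 1 = (s, d)" by (cases "a ! 1")
    obtain f h where fh: "snd b ! 1 = (f, h)" by (cases "snd b ! 1")
    have "snd c ! 1 = (f(h := s), h + displacement d)"
      using c la IH T sd fh by simp
    moreover have "displacement d \<le> 1" by (cases d) auto
    ultimately show ?thesis using IH c la fh by auto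
  qed
qed

lemma queried_word_length:
  assumes "wf_otm M" "(step M D ^^ i) (init M x) c" "holds_word (snd c ! 1) w"
  shows "length w \<le> i"
proof (rule ccontr)
  assume "\<not> length w \<le> i"
  then have "fst (snd c ! 1) (int i) = Bit (w ! i)" using assms(3) by (simp add: holds_word_def)
  then show False using query_tape_bound[OF assms(1,2)] by auto
qed

text \<open>A query has a successor whatever the answer, and all other steps ignore the
  oracle.\<close>

lemma halted_oracle_irrelevant: "halted M D c \<longleftrightarrow> halted M E c"
  by (auto simp: halted_def step_def)

lemma step_cong:
  assumes "\<And>w. holds_word (snd c ! 1) w \<Longrightarrow> w \<in> D \<longleftrightarrow> w \<in> E"
  shows "step M D c c' \<longleftrightarrow> step M E c c'"
proof -
  have "(\<exists>w\<in>D. holds_word (snd c ! 1) w) \<longleftrightarrow> (\<exists>w\<in>E. holds_word (snd c ! 1) w)"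
    using assms by blast
  then show ?thesis by (simp add: step_def)
qed

text \<open>Agreement is required only for words met in runs with oracle \<open>D\<close>; by
  induction these are also the runs with oracle \<open>E\<close>.\<close>

lemma relpowp_step_cong:
  assumes "\<And>i c w. i < k \<Longrightarrow> (step M D ^^ i) c0 c \<Longrightarrow> holds_word (snd c ! 1) w \<Longrightarrow> w \<in> D \<longleftrightarrow> w \<in> E"
    and "i \<le> k"
  shows "(step M D ^^ i) c0 c \<longleftrightarrow> (step M E ^^ i) c0 c"
  using assms(2)
proof (induction i arbitrary: c)
  case (Suc i)
  then have IH: "(step M D ^^ i) c0 b \<longleftrightarrow> (step M E ^^ i) c0 b" for b by simp
  have "step M D b c \<longleftrightarrow> step M E b c" if "(step M D ^^ i) c0 b" for b
    by (rule step_cong) (use assms(1)[of i b] that Suc.prems in auto)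
  then show ?case using IH by (auto simp: OO_def)
qed simp

text \<open>Step number \<open>Suc t\<close> starts from a configuration reached after
  \<open>t\<close> steps, whose query word has length at most \<open>t\<close>. This extra step is
  what allows time bounds to be transferred.\<close>

lemma relpowp_init_cong:
  assumes "wf_otm M" "\<And>w. length w \<le> t \<Longrightarrow> w \<in> D \<longleftrightarrow> w \<in> E" "i \<le> Suc t"
  shows "(step M D ^^ i) (init M x) c \<longleftrightarrow> (step M E ^^ i) (init M x) c"
proof (rule relpowp_step_cong[of "Suc t"])
  fix i c w assume "i < Suc t" "(step M D ^^ i) (init M x) c" "holds_word (snd c ! 1) w"
  then show "w \<in> D \<longleftrightarrow> w \<in> E" using queried_word_length[OF assms(1)] assms(2) by fastforce
qed (use assms in auto)

section \<open>Determinism and time bounds\<close>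

lemma deterministic_step:
  assumes "deterministic M" "step M D c c1" "step M D c c2"
  shows "c1 = c2"
proof (cases "fst c = query_state M")
  case True
  then show ?thesis using assms(2,3) by (simp add: step_def)
next
  case False
  obtain q1 a1 where 1: "((fst c, map scan (snd c)), (q1, a1)) \<in> transitions M"
    "c1 = (q1, map2 act a1 (snd c))" using assms(2) False unfolding step_def by auto
  obtain q2 a2 where 2: "((fst c, map scan (snd c)), (q2, a2)) \<in> transitions M"
    "c2 = (q2, map2 act a2 (snd c))" using assms(3) False unfolding step_def by auto
  have "(q1, a1) = (q2, a2)" using assms(1) 1(1) 2(1) unfolding deterministic_def by blast
  then show ?thesis using 1 2 by simp
qed

lemma deterministic_relpowp:
  assumes "deterministic M" "(step M D ^^ i) c c1" "(step M D ^^ i) c c2"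
  shows "c1 = c2"
  using assms(2,3)
proof (induction i arbitrary: c1 c2)
  case (Suc i)
  obtain d1 where d1: "(step M D ^^ i) c d1" "step M D d1 c1" using Suc.prems(1) by auto
  obtain d2 where d2: "(step M D ^^ i) c d2" "step M D d2 c2" using Suc.prems(2) by auto
  have "d1 = d2" using Suc.IH d1(1) d2(1) .
  then show ?case using deterministic_step[OF assms(1)] d1(2) d2(2) by blast
qed simp

definition time_bounded :: "otm \<Rightarrow> language \<Rightarrow> config \<Rightarrow> nat \<Rightarrow> bool" where
  "time_bounded M D c k \<longleftrightarrow> (\<forall>t c'. (step M D ^^ t) c c' \<longrightarrow> t \<le> k)"

lemma time_bounded_halted: "halted M D c \<Longrightarrow> time_bounded M D c k"
  unfolding time_bounded_def halted_def
  by (metis le0 not0_implies_Suc relpowp_Suc_E2)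

lemma time_bounded_Suc:
  assumes "\<And>c'. step M D c c' \<Longrightarrow> time_bounded M D c' k"
  shows "time_bounded M D c (Suc k)"
  using assms unfolding time_bounded_def
  by (metis Suc_le_mono le0 not0_implies_Suc relpowp_Suc_E2)

lemma time_bounded_step:
  assumes "time_bounded M D c (Suc k)" "step M D c c'"
  shows "time_bounded M D c' k"
  using assms unfolding time_bounded_def by (metis Suc_le_mono relpowp_Suc_I2)

text \<open>A longer run would pass through \<open>d\<close>, the only configuration reachable in
  \<open>k\<close> steps, but \<open>d\<close> has no successor.\<close>

lemma time_bounded_deterministic:
  assumes "deterministic M" "(step M D ^^ k) c d" "halted M D d"
  shows "time_bounded M D c k"
  unfolding time_bounded_def
proof (intro allI impI, rule ccontr)
  fix t c' assume t: "(step M D ^^ t) c c'" "\<not> t \<le> k"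
  then have "(step M D ^^ (Suc k + (t - Suc k))) c c'" by simp
  then obtain b where "(step M D ^^ Suc k) c b" unfolding relpowp_add by blast
  then obtain e where "(step M D ^^ k) c e" "step M D e b" by auto
  moreover from this have "d = e" using deterministic_relpowp[OF assms(1,2)] by blast
  ultimately show False using assms(3) unfolding halted_def by blast
qed

text \<open>A run of more than \<open>t\<close> steps begins with a run of exactly
  \<open>Suc t\<close> steps, and such runs are the same for both oracles.\<close>

lemma time_bounded_init_cong:
  assumes "wf_otm M" "\<And>w. length w \<le> t \<Longrightarrow> w \<in> D \<longleftrightarrow> w \<in> E" "time_bounded M D (init M x) t"
  shows "time_bounded M E (init M x) t"
  unfolding time_bounded_def
proof (intro allI impI, rule ccontr)
  fix s c' assume t: "(step M E ^^ s) (init M x) c'" "\<not> s \<le> t"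
  then have "(step M E ^^ (Suc t + (s - Suc t))) (init M x) c'" by simp
  then obtain b where "(step M E ^^ Suc t) (init M x) b" unfolding relpowp_add by blast
  then have "(step M D ^^ Suc t) (init M x) b"
    using relpowp_init_cong[of M t D E "Suc t"] assms(1,2) by blast
  then show False using assms(3) unfolding time_bounded_def by fastforce
qed

section \<open>Counting accepting paths by recursion on the first step\<close>

definition paths_from :: "otm \<Rightarrow> language \<Rightarrow> config \<Rightarrow> config list set" where
  "paths_from M D c =
     {cs. cs \<noteq> [] \<and> hd cs = c \<and> successively (step M D) cs \<and>
          halted M D (last cs) \<and> fst (last cs) = accept_state M}"

lemma accepting_paths_eq: "accepting_paths M D x = paths_from M D (init M x)"
  by (simp add: accepting_paths_def paths_from_def)

lemma paths_from_halted:
  assumes "halted M D c"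
  shows "paths_from M D c = (if fst c = accept_state M then {[c]} else {})"
proof -
  have "cs = [c]" if "cs \<in> paths_from M D c" for cs
  proof (cases cs)
    case (Cons a list)
    then show ?thesis using that assms
      by (cases list) (auto simp: paths_from_def halted_def)
  qed (use that in \<open>simp add: paths_from_def\<close>)
  moreover have "[c] \<in> paths_from M D c \<longleftrightarrow> fst c = accept_state M"
    using assms by (simp add: paths_from_def)
  ultimately show ?thesis by auto
qed

lemma paths_from_step:
  assumes "\<not> halted M D c"
  shows "paths_from M D c = (\<Union>c' \<in> {c'. step M D c c'}. (#) c ` paths_from M D c')"
proof (intro set_eqI iffI)
  fix cs assume cs: "cs \<in> paths_from M D c"
  then obtain a ds where 1: "cs = a # ds" by (cases cs) (auto simp: paths_from_def)
  then obtain b es where 2: "ds = b # es" using cs assms by (cases ds) (auto simp: paths_from_def)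
  show "cs \<in> (\<Union>c' \<in> {c'. step M D c c'}. (#) c ` paths_from M D c')"
  proof (rule UN_I[of b])
    show "b \<in> {c'. step M D c c'}" using cs 1 2 by (auto simp: paths_from_def)
    have "ds \<in> paths_from M D b" using cs 1 2 by (auto simp: paths_from_def)
    then show "cs \<in> (#) c ` paths_from M D b" using cs 1 by (auto simp: paths_from_def)
  qed
next
  fix cs assume "cs \<in> (\<Union>c' \<in> {c'. step M D c c'}. (#) c ` paths_from M D c')"
  then obtain c' ds where "step M D c c'" "ds \<in> paths_from M D c'" "cs = c # ds" by blast
  then show "cs \<in> paths_from M D c"
    by (simp add: paths_from_def successively_Cons)
qed

lemma successors_finite:
  assumes "wf_otm M"
  shows "finite {c'. step M D c c'} \<and> card {c'. step M D c c'} \<le> Suc (card (transitions M))"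
proof -
  let ?F = "(\<lambda>(l, (q', a)). (q', map2 act a (snd c))) ` transitions M"
  let ?q = "(if \<exists>w\<in>D. holds_word (snd c ! 1) w then yes_state M else no_state M, snd c)"
  have fin: "finite (transitions M)" using assms by (simp add: wf_otm_def)
  have sub: "{c'. step M D c c'} \<subseteq> insert ?q ?F"
    by (force simp: step_def image_iff split: if_splits)
  have "card (insert ?q ?F) \<le> Suc (card ?F)" using fin by (simp add: card_insert_if)
  also have "\<dots> \<le> Suc (card (transitions M))" using fin by (simp add: card_image_le)
  finally show ?thesis using sub fin
    by (meson card_mono finite.insertI finite_imageI finite_subset le_trans)
qed

text \<open>The computation tree has depth at most \<open>t\<close> and branching at most
  \<open>Suc (card (transitions M))\<close>, where \<open>Suc\<close> covers the query step.\<close>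

lemma paths_from_finite:
  assumes "wf_otm M" "time_bounded M D c t"
  shows "finite (paths_from M D c) \<and> card (paths_from M D c) \<le> Suc (card (transitions M)) ^ t"
  using assms(2)
proof (induction t arbitrary: c)
  case 0
  have "halted M D c"
    using 0 unfolding time_bounded_def halted_def by (metis not_one_le_zero relpowp_1)
  then show ?case by (simp add: paths_from_halted)
next
  case (Suc t)
  let ?B = "Suc (card (transitions M))" and ?S = "{c'. step M D c c'}"
  show ?case
  proof (cases "halted M D c")
    case True
    have "1 \<le> ?B ^ Suc t" using one_le_power[of ?B "Suc t"] by simp
    then show ?thesis using True by (simp add: paths_from_halted)
  next
    case False
    have IH: "finite (paths_from M D c') \<and> card (paths_from M D c') \<le> ?B ^ t" if "c' \<in> ?S" for c'
      using Suc.IH time_bounded_step[OF Suc.prems] that by auto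
    have "card (paths_from M D c) \<le> (\<Sum>c'\<in>?S. card ((#) c ` paths_from M D c'))"
      unfolding paths_from_step[OF False]
      by (rule card_UN_le) (use successors_finite[OF assms(1)] in blast)
    also have "\<dots> \<le> (\<Sum>c'\<in>?S. ?B ^ t)"
      by (rule sum_mono) (use IH in \<open>auto simp: card_image\<close>)
    also have "\<dots> \<le> ?B * ?B ^ t"
      using successors_finite[OF assms(1), of D c] by (simp del: mult_Suc)
    finally show ?thesis
      unfolding paths_from_step[OF False] using successors_finite[OF assms(1), of D c] IH by auto
  qed
qed

lemma card_paths_from_step:
  assumes "wf_otm M" "time_bounded M D c t" "\<not> halted M D c"
  shows "card (paths_from M D c) = (\<Sum>c' \<in> {c'. step M D c c'}. card (paths_from M D c'))"
proof -
  have fin: "finite (paths_from M D c')" if "step M D c c'" for c'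
  proof -
    have "time_bounded M D c (Suc t)" using assms(2) unfolding time_bounded_def by fastforce
    then show ?thesis using paths_from_finite[OF assms(1)] time_bounded_step that by blast
  qed
  have "card (paths_from M D c) = (\<Sum>c'\<in>{c'. step M D c c'}. card ((#) c ` paths_from M D c'))"
    unfolding paths_from_step[OF assms(3)]
    by (rule card_UN_disjoint)
      (use successors_finite[OF assms(1)] fin in \<open>auto simp: paths_from_def\<close>)
  also have "\<dots> = (\<Sum>c' \<in> {c'. step M D c c'}. card (paths_from M D c'))"
    by (simp add: card_image)
  finally show ?thesis .
qed

lemma successively_relpowp:
  assumes "successively R cs" "i < length cs"
  shows "(R ^^ i) (hd cs) (cs ! i)"
  using assms(2)
proof (induction i)
  case 0 then show ?case by (simp add: hd_conv_nth)
next
  case (Suc i)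
  then have "R (cs ! i) (cs ! Suc i)" using assms(1) by (simp add: successively_conv_nth)
  then show ?case using Suc by auto
qed

text \<open>No configuration of a path within time \<open>t\<close> has a query word longer than
  \<open>t\<close>. One inclusion is shown for arbitrary oracles and used in both directions, which
  is possible because the time bound transfers too.\<close>

lemma accepting_paths_cong:
  assumes "wf_otm M" "\<And>w. length w \<le> t \<Longrightarrow> w \<in> D \<longleftrightarrow> w \<in> E" "time_bounded M D (init M x) t"
  shows "accepting_paths M D x = accepting_paths M E x"
proof -
  have *: "accepting_paths M D x \<subseteq> accepting_paths M E x"
    if a: "\<And>w. length w \<le> t \<Longrightarrow> w \<in> D \<longleftrightarrow> w \<in> E" and b: "time_bounded M D (init M x) t" for D E
  proof
    fix cs assume cs: "cs \<in> accepting_paths M D x"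
    have "step M E (cs ! i) (cs ! Suc i)" if i: "Suc i < length cs" for i
    proof -
      have r: "(step M D ^^ i) (init M x) (cs ! i)"
        using successively_relpowp[of "step M D" cs i] cs i by (auto simp: accepting_paths_def)
      then have "i \<le> t" using b unfolding time_bounded_def by blast
      moreover have "step M D (cs ! i) (cs ! Suc i)"
        using cs i by (auto simp: accepting_paths_def successively_conv_nth)
      ultimately show ?thesis
        using step_cong[of "cs ! i" D E] queried_word_length[OF assms(1) r] a by fastforce
    qed
    then show "cs \<in> accepting_paths M E x"
      using cs halted_oracle_irrelevant[of M D _ E]
      by (auto simp: accepting_paths_def successively_conv_nth)
  qed
  have "time_bounded M E (init M x) t" by (rule time_bounded_init_cong[OF assms])
  then show ?thesis using *[of D E] *[of E D] assms(2,3) by auto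
qed

section \<open>The deterministic reader\<close>

definition word_tape :: "bool list \<Rightarrow> tape" where
  "word_tape w = (fst (input_tape (map Bit w)), int (length w))"

lemma input_tape_Nil: "input_tape [] = word_tape []"
  by (simp add: word_tape_def input_tape_def)

lemma scan_word_tape [simp]: "scan (word_tape w) = Blank"
  by (simp add: word_tape_def input_tape_def)

lemma input_tape_snoc:
  "(fst (input_tape (map Bit w)))(int (length w) := Bit b) = fst (input_tape (map Bit (w @ [b])))"
  by (auto simp: input_tape_def fun_eq_iff nth_append)

lemma act_word_tape_right [simp]: "act (Bit b, MRight) (word_tape w) = word_tape (w @ [b])"
  using input_tape_snoc[of w b] by (simp add: word_tape_def)

lemma act_word_tape_stay [simp]:
  "act (Bit b, MStay) (word_tape w) = (fst (input_tape (map Bit (w @ [b]))), int (length w))"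
  using input_tape_snoc[of w b] by (simp add: word_tape_def)

lemma act_Blank_word_tape [simp]: "act (Blank, MStay) (word_tape w) = word_tape w"
  by (auto simp: word_tape_def input_tape_def fun_eq_iff)

lemma holds_word_tape: "holds_word (word_tape w) v \<longleftrightarrow> v = w"
proof -
  have "holds_word (word_tape w) w"
    by (auto simp: holds_word_def word_tape_def input_tape_def)
  then show ?thesis using holds_word_unique by blast
qed

text \<open>
  The reader writes u, a unary copy of its input and a separator on the query tape; from then on it
  queries and appends a one in turn. The answers are alternately the next output bit and whether to
  stop. As there is only one query state, the scanned output cell records which of the two is pending.
\<close>

definition reader :: "symbol \<Rightarrow> bool list \<Rightarrow> otm" where
  "reader s u = (let l = length u in
    \<lparr>tapes = 3,
     transitions =
       (\<lambda>(i, x). ((i, [x, Blank, Blank]),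
                  (Suc i, [(x, MStay), (Bit (u ! i), MRight), (Blank, MStay)])))
         ` ({..<l} \<times> {Blank, s}) \<union>
       {((l, [s, Blank, Blank]), (l, [(s, MRight), (Bit True, MRight), (Blank, MStay)])),
        ((l, [Blank, Blank, Blank]), (l + 1, [(Blank, MStay), (Bit False, MRight), (Blank, MStay)])),
        ((l + 2, [Blank, Blank, Blank]), (l + 1, [(Blank, MStay), (Bit True, MRight), (Bit True, MStay)])),
        ((l + 3, [Blank, Blank, Blank]), (l + 1, [(Blank, MStay), (Bit True, MRight), (Bit False, MStay)])),
        ((l + 3, [Blank, Blank, Bit False]),
          (l + 1, [(Blank, MStay), (Bit True, MRight), (Bit False, MRight)])),
        ((l + 3, [Blank, Blank, Bit True]),
          (l + 1, [(Blank, MStay), (Bit True, MRight), (Bit True, MRight)]))},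
     start_state = 0, accept_state = 0,
     query_state = l + 1, yes_state = l + 2, no_state = l + 3\<rparr>)"

lemma wf_reader: "wf_otm (reader s u)"
  by (auto simp: reader_def wf_otm_def Let_def)

text \<open>If \<open>s\<close> were \<open>Blank\<close>, the two rules of state \<open>l\<close>,
  for copying and for the separator, would clash.\<close>

lemma deterministic_reader: "s \<noteq> Blank \<Longrightarrow> deterministic (reader s u)"
  by (auto simp: reader_def deterministic_def Let_def)

lemma reader_simps [simp]:
  "tapes (reader s u) = 3" "start_state (reader s u) = 0" "query_state (reader s u) = length u + 1"
  "yes_state (reader s u) = length u + 2" "no_state (reader s u) = length u + 3"
  by (simp_all add: reader_def Let_def)

lemma reader_step:
  assumes "((q, [scan t0, scan t1, scan t2]), (q', [a0, a1, a2])) \<in> transitions (reader s u)"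
    and "q \<noteq> length u + 1"
  shows "step (reader s u) D (q, [t0, t1, t2]) (q', [act a0 t0, act a1 t1, act a2 t2])"
  unfolding step_def using assms
  by (simp del: act.simps) (intro exI[of _ "[a0, a1, a2]"], simp del: act.simps)

lemma reader_query:
  "step (reader s u) D (length u + 1, [t0, word_tape w, t2])
     (if w \<in> D then length u + 2 else length u + 3, [t0, word_tape w, t2])"
  by (simp add: step_def holds_word_tape)

lemma reader_prefix:
  assumes "i \<le> length u"
  shows "(step (reader s u) D ^^ i) (init (reader s u) (replicate n s))
           (i, [input_tape (replicate n s), word_tape (take i u), word_tape []])"
  using assms
proof (induction i)
  case 0
  show ?case by (simp add: init_def numeral_2_eq_2 input_tape_Nil)
next
  case (Suc i)
  let ?t = "input_tape (replicate n s)"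
  \<comment> \<open>For \<open>n = 0\<close> the scanned cell is blank; this is why the prefix rules
    exist for \<open>Blank\<close> as well as for \<open>s\<close>.\<close>
  have sc: "scan ?t \<in> {Blank, s}" by (simp add: input_tape_def)
  have "step (reader s u) D (i, [?t, word_tape (take i u), word_tape []])
     (Suc i, [act (scan ?t, MStay) ?t, act (Bit (u ! i), MRight) (word_tape (take i u)),
         act (Blank, MStay) (word_tape [])])"
    by (rule reader_step) (use Suc.prems sc in \<open>auto simp: reader_def Let_def\<close>)
  moreover have "act (scan ?t, MStay) ?t = ?t"
    by (cases ?t) simp
  ultimately have "step (reader s u) D (i, [?t, word_tape (take i u), word_tape []])
     (Suc i, [?t, word_tape (take (Suc i) u), word_tape []])"
    using Suc.prems by (simp add: take_Suc_conv_app_nth)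
  then show ?case using Suc by auto
qed

lemma reader_copy:
  assumes "i \<le> n" "s \<noteq> Blank"
  shows "(step (reader s u) D ^^ (length u + i)) (init (reader s u) (replicate n s))
           (length u, [(fst (input_tape (replicate n s)), int i), word_tape (u @ replicate i True),
               word_tape []])"
  using assms(1)
proof (induction i)
  case 0
  show ?case using reader_prefix[of "length u" u s D n] by (simp add: input_tape_def)
next
  case (Suc i)
  let ?t = "fst (input_tape (replicate n s))"
  have sc: "?t (int i) = s" using Suc.prems by (simp add: input_tape_def)
  have "step (reader s u) D (length u, [(?t, int i), word_tape (u @ replicate i True), word_tape []])
     (length u, [act (s, MRight) (?t, int i), act (Bit True, MRight) (word_tape (u @ replicate i True)),
         act (Blank, MStay) (word_tape [])])"
    by (rule reader_step) (use sc in \<open>auto simp: reader_def Let_def\<close>)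
  moreover have "act (s, MRight) (?t, int i) = (?t, int (Suc i))"
    using sc by auto
  ultimately have "step (reader s u) D (length u, [(?t, int i), word_tape (u @ replicate i True), word_tape []])
     (length u, [(?t, int (Suc i)), word_tape (u @ replicate (Suc i) True), word_tape []])"
    by (simp del: act.simps add: replicate_append_same)
  then show ?case using Suc by auto
qed

text \<open>Here \<open>k\<close> numbers the queries of one run: even \<open>k\<close> asks for an
  output bit, odd \<open>k\<close> whether to stop.\<close>

definition query_word :: "bool list \<Rightarrow> nat \<Rightarrow> nat \<Rightarrow> bool list" where
  "query_word u n k = u @ replicate n True @ False # replicate k True"

lemma query_word_Suc: "query_word u n k @ [True] = query_word u n (Suc k)"
  by (simp add: query_word_def replicate_append_same)

lemma relpowp_three:
  assumes "(R ^^ k) a b" "R b c" "R c d" "R d e"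
  shows "(R ^^ (k + 3)) a e"
proof -
  have "(R ^^ Suc (Suc (Suc k))) a e" using assms by (meson relpowp_Suc_I)
  then show ?thesis by (simp add: numeral_3_eq_3)
qed

text \<open>The three steps are a query, writing its answer, and a second query. The output head
  stays on the new bit, which marks the second answer as a stop signal.\<close>

lemma reader_round:
  fixes n m u D s
  defines "t \<equiv> (fst (input_tape (replicate n s)), int n)"
    and "b \<equiv> query_word u n (2 * m) \<in> D"
    and "q \<equiv> query_word u n (2 * m + 1)"
  assumes "(step (reader s u) D ^^ k) c (length u + 1, [t, word_tape (query_word u n (2 * m)), word_tape v])"
  shows "(step (reader s u) D ^^ (k + 3)) c
           (if q \<in> D then length u + 2 else length u + 3,
            [t, word_tape q, (fst (input_tape (map Bit (v @ [b]))), int (length v))])"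
proof (rule relpowp_three[OF assms(4)])
  let ?l = "length u" and ?w = "word_tape (query_word u n (2 * m))"
  have sc: "scan t = Blank" by (simp add: t_def input_tape_def)
  then have a0: "act (Blank, MStay) t = t" by (auto simp: t_def)
  show "step (reader s u) D (?l + 1, [t, ?w, word_tape v]) (if b then ?l + 2 else ?l + 3, [t, ?w, word_tape v])"
    unfolding b_def by (rule reader_query)
  have "step (reader s u) D (if b then ?l + 2 else ?l + 3, [t, ?w, word_tape v])
      (?l + 1, [act (Blank, MStay) t, act (Bit True, MRight) ?w, act (Bit b, MStay) (word_tape v)])"
    by (rule reader_step) (use sc in \<open>auto simp: reader_def Let_def\<close>)
  then show "step (reader s u) D (if b then ?l + 2 else ?l + 3, [t, ?w, word_tape v])
      (?l + 1, [t, word_tape q, (fst (input_tape (map Bit (v @ [b]))), int (length v))])"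
    unfolding a0 act_word_tape_right act_word_tape_stay query_word_Suc q_def by simp
qed (rule reader_query)

text \<open>A continuing round takes four steps: the three of \<open>reader_round\<close> and one
  that moves the output head past the new bit. The other \<open>length u + n + 1\<close> steps write
  the prefix, the unary copy and the separator.\<close>

lemma reader_loop:
  assumes "s \<noteq> Blank" "\<And>i. i < m \<Longrightarrow> query_word u n (2 * i + 1) \<notin> D"
  shows "(step (reader s u) D ^^ (length u + n + 1 + 4 * m)) (init (reader s u) (replicate n s))
           (length u + 1, [(fst (input_tape (replicate n s)), int n), word_tape (query_word u n (2 * m)),
              word_tape (map (\<lambda>i. query_word u n (2 * i) \<in> D) [0..<m])])"
  using assms(2)
proof (induction m)
  case 0
  let ?t = "fst (input_tape (replicate n s))"
  have sc: "?t (int n) = Blank" by (simp add: input_tape_def)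
  have "step (reader s u) D (length u, [(?t, int n), word_tape (u @ replicate n True), word_tape []])
     (length u + 1, [act (Blank, MStay) (?t, int n),
        act (Bit False, MRight) (word_tape (u @ replicate n True)), act (Blank, MStay) (word_tape [])])"
    by (rule reader_step) (use sc in \<open>auto simp: reader_def Let_def\<close>)
  moreover have "act (Blank, MStay) (?t, int n) = (?t, int n)"
    using sc by auto
  ultimately have "step (reader s u) D (length u, [(?t, int n), word_tape (u @ replicate n True), word_tape []])
     (length u + 1, [(?t, int n), word_tape (query_word u n 0), word_tape []])"
    by (simp del: act.simps add: query_word_def)
  then show ?case using reader_copy[of n n s u D] assms(1) by auto
next
  case (Suc m)
  define t where "t = (fst (input_tape (replicate n s)), int n)"
  define v where "v = map (\<lambda>i. query_word u n (2 * i) \<in> D) [0..<m]"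
  define b where "b \<longleftrightarrow> query_word u n (2 * m) \<in> D"
  define o' where "o' = (fst (input_tape (map Bit (v @ [b]))), int (length v))"
  let ?R = "step (reader s u) D" and ?l = "length u"
  have sc: "scan t = Blank" by (simp add: t_def input_tape_def)
  then have a0: "act (Blank, MStay) t = t" by (auto simp: t_def)
  have so: "scan o' = Bit b" by (simp add: o'_def input_tape_def nth_append)
  then have ao: "act (Bit b, MRight) o' = word_tape (v @ [b])"
    by (auto simp: o'_def word_tape_def)
  have "(?R ^^ (?l + n + 1 + 4 * m)) (init (reader s u) (replicate n s))
      (?l + 1, [t, word_tape (query_word u n (2 * m)), word_tape v])"
    using Suc by (simp add: t_def v_def)
  from reader_round[OF this[unfolded t_def]]
  have 3: "(?R ^^ (?l + n + 1 + 4 * m + 3)) (init (reader s u) (replicate n s))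
      (?l + 3, [t, word_tape (query_word u n (2 * m + 1)), o'])"
    using Suc.prems[of m] by (simp add: t_def o'_def b_def)
  have "((?l + 3, [scan t, scan (word_tape (query_word u n (2 * m + 1))), scan o']),
      (?l + 1, [(Blank, MStay), (Bit True, MRight), (Bit b, MRight)])) \<in> transitions (reader s u)"
    unfolding so sc scan_word_tape by (cases b) (simp_all add: reader_def Let_def)
  from reader_step[OF this]
  have 4: "?R (?l + 3, [t, word_tape (query_word u n (2 * m + 1)), o'])
      (?l + 1, [t, word_tape (query_word u n (2 * Suc m)), word_tape (v @ [b])])"
    unfolding a0 act_word_tape_right ao query_word_Suc by simp
  have "(?R ^^ Suc (?l + n + 1 + 4 * m + 3)) (init (reader s u) (replicate n s))
      (?l + 1, [t, word_tape (query_word u n (2 * Suc m)), word_tape (v @ [b])])"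
    using relpowp_Suc_I[OF 3 4] .
  moreover have "Suc (?l + n + 1 + 4 * m + 3) = ?l + n + 1 + 4 * Suc m" by simp
  ultimately show ?case by (simp only: t_def v_def b_def upt_Suc_append map_append list.map le0)
qed

lemma reader_final:
  assumes "s \<noteq> Blank" "\<And>i. i < m \<Longrightarrow> query_word u n (2 * i + 1) \<notin> D" "query_word u n (2 * m + 1) \<in> D"
  shows "\<exists>c. (step (reader s u) D ^^ (length u + n + 4 + 4 * m)) (init (reader s u) (replicate n s)) c \<and>
     halted (reader s u) D c \<and>
     holds_word (snd c ! 2) (map (\<lambda>i. query_word u n (2 * i) \<in> D) [0..<Suc m])"
proof -
  define t where "t = (fst (input_tape (replicate n s)), int n)"
  define v where "v = map (\<lambda>i. query_word u n (2 * i) \<in> D) [0..<m]"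
  define b where "b \<longleftrightarrow> query_word u n (2 * m) \<in> D"
  define o' where "o' = (fst (input_tape (map Bit (v @ [b]))), int (length v))"
  define c where "c = (length u + 2, [t, word_tape (query_word u n (2 * m + 1)), o'])"
  have "scan t = Blank" by (simp add: t_def input_tape_def)
  moreover have "scan o' = Bit b" by (simp add: o'_def input_tape_def nth_append)
  \<comment> \<open>The yes state has no rule for a bit under the output head, so a positive answer
    to an odd-numbered query halts the machine.\<close>
  ultimately have "halted (reader s u) D c"
    by (auto simp: c_def halted_def step_def reader_def Let_def)
  moreover have "(step (reader s u) D ^^ (length u + n + 1 + 4 * m + 3)) (init (reader s u) (replicate n s)) c"
    using reader_round[OF reader_loop[of s m u n D]] assms
    by (simp add: c_def t_def o'_def b_def v_def)
  moreover have "length u + n + 1 + 4 * m + 3 = length u + n + 4 + 4 * m" by simp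
  moreover have "holds_word (snd c ! 2) (v @ [b])"
    using holds_word_tape[of "v @ [b]" "v @ [b]"]
    by (simp add: c_def o'_def holds_word_def word_tape_def numeral_2_eq_2)
  moreover have "v @ [b] = map (\<lambda>i. query_word u n (2 * i) \<in> D) [0..<Suc m]"
    by (simp add: v_def b_def)
  ultimately show ?thesis by metis
qed

section \<open>The nondeterministic guesser\<close>

text \<open>State 1 copies an input bit, state 2 appends a guessed bit, state 3 queries. The yes
  state is the accepting state, so a path accepts exactly if its guess leads to a word of the
  oracle.\<close>

definition guesser :: otm where
  "guesser =
    \<lparr>tapes = 3,
     transitions =
       (\<lambda>x. ((0, [x, Blank, Blank]), (1, [(x, MStay), (Bit False, MRight), (Blank, MStay)])))
         ` {Blank, Bit False, Bit True} \<union>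
       (\<lambda>b. ((1, [Bit b, Blank, Blank]), (2, [(Bit b, MStay), (Bit b, MRight), (Blank, MStay)]))) ` UNIV \<union>
       (\<lambda>(b, g). ((2, [Bit b, Blank, Blank]), (1, [(Bit b, MRight), (Bit g, MRight), (Blank, MStay)]))) ` UNIV \<union>
       {((1, [Blank, Blank, Blank]), (3, [(Blank, MStay), (Blank, MStay), (Blank, MStay)]))},
     start_state = 0, accept_state = 4, query_state = 3, yes_state = 4, no_state = 5\<rparr>"

lemma wf_guesser: "wf_otm guesser"
  by (auto simp: guesser_def wf_otm_def)

section \<open>Interleaved words and blocks\<close>

fun interleave :: "'a list \<Rightarrow> 'a list \<Rightarrow> 'a list" where
  "interleave (a # x) (b # y) = a # b # interleave x y"
| "interleave _ _ = []"

lemma length_interleave: "length x = length y \<Longrightarrow> length (interleave x y) = 2 * length x"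
  by (induction x y rule: list_induct2) auto

lemma interleave_inject:
  assumes "length x = length y" "length x' = length y'" "interleave x y = interleave x' y'"
  shows "x = x' \<and> y = y'"
  using assms
proof (induction x y arbitrary: x' y' rule: list_induct2)
  case Nil
  then show ?case by (cases x'; cases y') auto
next
  case (Cons a x b y)
  then show ?case by (cases x'; cases y') auto
qed

text \<open>Interleaving lets the guesser produce the word in one pass over \<open>x\<close>; the
  leading \<open>False\<close> marks it as a word taken from \<open>A\<close>.\<close>

definition block_word :: "bool list \<Rightarrow> bool list \<Rightarrow> bool list" where
  "block_word x y = False # interleave x y"

definition block_count :: "language \<Rightarrow> bool list \<Rightarrow> nat" where
  "block_count D x = card {y. length y = length x \<and> block_word x y \<in> D}"

lemma finite_lists_length: "finite {y :: bool list. length y = n \<and> P y}"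
  by (rule finite_subset[OF _ finite_lists_length_eq[of UNIV n]]) auto

lemma card_lists_Suc:
  "card {y :: bool list. length y = Suc n \<and> P y} =
   card {y. length y = n \<and> P (False # y)} + card {y. length y = n \<and> P (True # y)}"
proof -
  have "{y. length y = Suc n \<and> P y} =
      (#) False ` {y. length y = n \<and> P (False # y)} \<union> (#) True ` {y. length y = n \<and> P (True # y)}"
  proof (intro set_eqI iffI)
    fix y assume "y \<in> {y. length y = Suc n \<and> P y}"
    then show "y \<in> (#) False ` {y. length y = n \<and> P (False # y)} \<union> (#) True ` {y. length y = n \<and> P (True # y)}"
      by (cases y; cases "hd y") auto
  qed auto
  then show ?thesis
    by (simp, subst card_Un_disjoint) (auto simp: finite_lists_length card_image)
qed

section \<open>Runs of the guesser\<close>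

abbreviation guesser_config :: "nat \<Rightarrow> bool list \<Rightarrow> nat \<Rightarrow> bool list \<Rightarrow> config" where
  "guesser_config q x i w \<equiv> (q, [(fst (input_tape (map Bit x)), int i), word_tape w, word_tape []])"

lemma successors_eq:
  assumes "fst c \<noteq> query_state M"
  shows "{c'. step M D c c'} =
    (\<lambda>(q', a). (q', map2 act a (snd c))) ` {r. ((fst c, map scan (snd c)), r) \<in> transitions M}"
  using assms by (force simp: step_def)

lemma guesser_transitions:
  "s \<in> {Blank, Bit False, Bit True} \<Longrightarrow> {r. ((0, [s, Blank, Blank]), r) \<in> transitions guesser} =
    {(1, [(s, MStay), (Bit False, MRight), (Blank, MStay)])}"
  "{r. ((1, [Bit b, Blank, Blank]), r) \<in> transitions guesser} =
    {(2, [(Bit b, MStay), (Bit b, MRight), (Blank, MStay)])}"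
  "{r. ((2, [Bit b, Blank, Blank]), r) \<in> transitions guesser} =
    {(1, [(Bit b, MRight), (Bit False, MRight), (Blank, MStay)]),
     (1, [(Bit b, MRight), (Bit True, MRight), (Blank, MStay)])}"
  "{r. ((1, [Blank, Blank, Blank]), r) \<in> transitions guesser} =
    {(3, [(Blank, MStay), (Blank, MStay), (Blank, MStay)])}"
  by (auto simp: guesser_def)

lemma guesser_simps [simp]: "query_state guesser = 3" "accept_state guesser = 4"
  by (simp_all add: guesser_def)

lemma guesser_step_0:
  "{c. step guesser D (init guesser (map Bit x)) c} = {guesser_config 1 x 0 [False]}"
proof -
  have i: "init guesser (map Bit x) = guesser_config 0 x 0 []"
    by (simp add: init_def guesser_def numeral_2_eq_2 input_tape_Nil) (simp add: input_tape_def)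
  have "fst (input_tape (map Bit x)) 0 \<in> {Blank, Bit False, Bit True}"
    by (auto simp: input_tape_def)
  then show ?thesis
    unfolding i by (subst successors_eq) (simp_all add: guesser_transitions(1))
qed

lemma guesser_step_1:
  assumes "i < length x"
  shows "{c. step guesser D (guesser_config 1 x i w) c} = {guesser_config 2 x i (w @ [x ! i])}"
proof -
  have "fst (input_tape (map Bit x)) (int i) = Bit (x ! i)" using assms by (simp add: input_tape_def)
  moreover have "(fst (input_tape (map Bit x)))(int i := Bit (x ! i)) = fst (input_tape (map Bit x))"
    using calculation by auto
  ultimately show ?thesis
    by (subst successors_eq) (simp_all add: guesser_transitions(2)[unfolded One_nat_def])
qed

lemma guesser_step_2:
  assumes "i < length x"
  shows "{c. step guesser D (guesser_config 2 x i w) c} =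
    {guesser_config 1 x (Suc i) (w @ [False]), guesser_config 1 x (Suc i) (w @ [True])}"
proof -
  have "fst (input_tape (map Bit x)) (int i) = Bit (x ! i)" using assms by (simp add: input_tape_def)
  moreover have "(fst (input_tape (map Bit x)))(int i := Bit (x ! i)) = fst (input_tape (map Bit x))"
    using calculation by auto
  ultimately show ?thesis
    by (subst successors_eq) (simp_all add: guesser_transitions(3) add.commute)
qed

lemma guesser_step_end:
  "{c. step guesser D (guesser_config 1 x (length x) w) c} = {guesser_config 3 x (length x) w}"
proof -
  have "fst (input_tape (map Bit x)) (int (length x)) = Blank" by (simp add: input_tape_def)
  moreover have "(fst (input_tape (map Bit x)))(int (length x) := Blank) = fst (input_tape (map Bit x))"
    using calculation by auto
  ultimately show ?thesis
    by (subst successors_eq) (simp_all add: guesser_transitions(4)[unfolded One_nat_def])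
qed

lemma guesser_step_query:
  "{c. step guesser D (guesser_config 3 x i w) c} = {guesser_config (if w \<in> D then 4 else 5) x i w}"
  by (auto simp: step_def guesser_def holds_word_tape)

lemma guesser_halted: "q \<in> {4, 5} \<Longrightarrow> halted guesser D (q, ts)"
  by (auto simp: halted_def step_def guesser_def)

lemma time_bounded_successors:
  assumes "{c'. step M D c c'} = S" "\<And>c'. c' \<in> S \<Longrightarrow> time_bounded M D c' k"
  shows "time_bounded M D c (Suc k)"
  by (rule time_bounded_Suc) (use assms in blast)

text \<open>Two steps for each of the \<open>k\<close> remaining input bits, one to enter the query
  state and one for the answer.\<close>

lemma guesser_time:
  assumes "i + k = length x"
  shows "time_bounded guesser D (guesser_config 1 x i w) (2 * k + 2)"
  using assms
proof (induction k arbitrary: i w)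
  case 0
  have "time_bounded guesser D (guesser_config (if w \<in> D then 4 else 5) x i w) 0"
    by (intro time_bounded_halted guesser_halted) auto
  then have "time_bounded guesser D (guesser_config 3 x i w) (Suc 0)"
    by (intro time_bounded_successors[OF guesser_step_query]) (simp only: singleton_iff)
  then have "time_bounded guesser D (guesser_config 1 x (length x) w) (Suc (Suc 0))"
    using 0 by (intro time_bounded_successors[OF guesser_step_end]) simp
  then show ?case using 0 by (simp add: numeral_2_eq_2)
next
  case (Suc k)
  then have i: "i < length x" by simp
  have "time_bounded guesser D (guesser_config 1 x (Suc i) v) (2 * k + 2)" for v
    by (rule Suc.IH) (use Suc.prems in simp)
  then have "time_bounded guesser D (guesser_config 2 x i v) (Suc (2 * k + 2))" for v
    by (intro time_bounded_successors[OF guesser_step_2[OF i]]) blast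
  then have "time_bounded guesser D (guesser_config 1 x i w) (Suc (Suc (2 * k + 2)))"
    by (intro time_bounded_successors[OF guesser_step_1[OF i]]) blast
  then show ?case by (simp add: numeral_2_eq_2)
qed

lemma guesser_time_init: "time_bounded guesser D (init guesser (map Bit x)) (2 * length x + 3)"
proof -
  have "time_bounded guesser D (init guesser (map Bit x)) (Suc (2 * length x + 2))"
    using guesser_time[of 0 "length x" x]
    by (intro time_bounded_successors[OF guesser_step_0]) auto
  then show ?thesis by (simp add: numeral_3_eq_3)
qed

lemma guesser_branch:
  assumes "time_bounded guesser D c t" "{c'. step guesser D c c'} = S" "S \<noteq> {}"
  shows "card (paths_from guesser D c) = (\<Sum>c' \<in> S. card (paths_from guesser D c'))"
proof -
  have "\<not> halted guesser D c" using assms(2,3) by (auto simp: halted_def)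
  then show ?thesis using card_paths_from_step[OF wf_guesser assms(1)] assms(2) by simp
qed

lemma word_tape_inject: "word_tape v = word_tape w \<longleftrightarrow> v = w"
  using holds_word_tape by metis

text \<open>The two outcomes of a guess split the words \<open>y\<close> by their first bit, as in
  \<open>card_lists_Suc\<close>; \<open>w\<close> is the part of the query written so far.\<close>

lemma guesser_count:
  assumes "i + k = length x"
  shows "card (paths_from guesser D (guesser_config 1 x i w)) =
         card {y. length y = k \<and> w @ interleave (drop i x) y \<in> D}"
  using assms
proof (induction k arbitrary: i w)
  case 0
  have tb: "time_bounded guesser D (guesser_config 1 x i w) (Suc 1)"
    using guesser_time[OF 0, of D w] by (simp add: numeral_2_eq_2)
  have s1: "{c. step guesser D (guesser_config 1 x i w) c} = {guesser_config 3 x i w}"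
    using guesser_step_end[of D x w] 0 by simp
  then have tb': "time_bounded guesser D (guesser_config 3 x i w) 1"
    using time_bounded_step[OF tb] by blast
  have "card (paths_from guesser D (guesser_config 1 x i w)) =
      card (paths_from guesser D (guesser_config (if w \<in> D then 4 else 5) x i w))"
    using guesser_branch[OF tb s1] guesser_branch[OF tb' guesser_step_query] by simp
  also have "\<dots> = (if w \<in> D then 1 else 0)"
    by (subst paths_from_halted) (auto simp: guesser_halted)
  also have "\<dots> = card {y. length y = 0 \<and> w @ interleave (drop i x) y \<in> D}"
  proof -
    have "interleave (drop i x) [] = []" by (cases "drop i x") auto
    then have "{y. length y = 0 \<and> w @ interleave (drop i x) y \<in> D} = (if w \<in> D then {[]} else {})"
      by auto
    then show ?thesis by simp
  qed
  finally show ?case .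
next
  case (Suc k)
  then have i: "i < length x" by simp
  have tb: "time_bounded guesser D (guesser_config 1 x i w) (Suc (2 * k + 3))"
    using guesser_time[OF Suc.prems, of D w] by (simp add: numeral_3_eq_3)
  note s1 = guesser_step_1[OF i, of D w]
  have tb': "time_bounded guesser D (guesser_config 2 x i (w @ [x ! i])) (2 * k + 3)"
    using time_bounded_step[OF tb] s1 by blast
  have dr: "drop i x = x ! i # drop (Suc i) x" using i by (simp add: Cons_nth_drop_Suc)
  \<comment> \<open>The two successors differ on the query tape, so the sum over the set of
    successors really has two terms.\<close>
  have "card (paths_from guesser D (guesser_config 1 x i w)) =
      card (paths_from guesser D (guesser_config 1 x (Suc i) (w @ [x ! i, False]))) +
      card (paths_from guesser D (guesser_config 1 x (Suc i) (w @ [x ! i, True])))"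
    using guesser_branch[OF tb s1] guesser_branch[OF tb' guesser_step_2[OF i]]
    by (simp add: word_tape_inject)
  also have "\<dots> = card {y. length y = Suc k \<and> w @ interleave (drop i x) y \<in> D}"
    unfolding card_lists_Suc dr using Suc.IH[of "Suc i"] Suc.prems by simp
  finally show ?case .
qed

lemma guesser_accepting_paths:
  "card (accepting_paths guesser D (map Bit x)) = block_count D x"
proof -
  have "card (accepting_paths guesser D (map Bit x)) =
      card (paths_from guesser D (guesser_config 1 x 0 [False]))"
    unfolding accepting_paths_eq using guesser_branch[OF guesser_time_init guesser_step_0] by simp
  then show ?thesis
    unfolding block_count_def block_word_def using guesser_count[of 0 "length x" x] by simp
qed

section \<open>The self-encoding set\<close>

instance symbol :: countable by countable_datatype
instance move :: countable by countable_datatype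

lemma countable_machines: "countable {M. wf_otm M}"
proof -
  let ?f = "\<lambda>(k, T, a, b, c, d, e). \<lparr>tapes = k, transitions = T, start_state = a, accept_state = b,
     query_state = c, yes_state = d, no_state = e\<rparr>"
  have "{M. wf_otm M} \<subseteq> ?f ` (UNIV \<times> {T. finite T} \<times> UNIV)"
  proof
    fix M assume "M \<in> {M. wf_otm M}"
    then have "finite (transitions M)" by (simp add: wf_otm_def)
    moreover have "M = ?f (tapes M, transitions M, start_state M, accept_state M,
      query_state M, yes_state M, no_state M)" by simp
    ultimately show "M \<in> ?f ` (UNIV \<times> {T. finite T} \<times> UNIV)" by blast
  qed
  moreover have "countable ((UNIV :: nat set) \<times> {T :: transition set. finite T} \<times>
      (UNIV :: (nat \<times> nat \<times> nat \<times> nat \<times> nat) set))"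
    using countable_Collect_finite by (intro countable_SIGMA) auto
  ultimately show ?thesis by (meson countable_image countable_subset)
qed

lemma countable_nat_polys: "countable (UNIV :: nat poly set)"
proof (rule countableI)
  show "inj (\<lambda>p :: nat poly. to_nat (coeffs p))"
    by (rule injI) (metis coeffs_eq_iff to_nat_split)
qed

definition programs :: "(otm \<times> nat poly \<times> symbol) set" where
  "programs = {M. wf_otm M} \<times> UNIV \<times> UNIV"

text \<open>The clock is arbitrary and need not bound the running time. The same enumeration
  supplies the machines to be encoded and those to be defeated.\<close>

definition program :: "nat \<Rightarrow> otm \<times> nat poly \<times> symbol" where
  "program = from_nat_into programs"

lemma program_surj:
  assumes "wf_otm M"
  shows "\<exists>j. program j = (M, p, s)"
proof -
  have "countable programs"
    unfolding programs_def using countable_machines countable_nat_polys by (intro countable_SIGMA) auto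
  moreover have "(M, p, s) \<in> programs" using assms by (simp add: programs_def)
  ultimately show ?thesis unfolding program_def by (metis from_nat_into_surj)
qed

section \<open>Code words\<close>

definition code_prefix :: "nat \<Rightarrow> bool list" where
  "code_prefix j = replicate (Suc j) True @ [False]"

definition code_word :: "nat \<Rightarrow> nat \<Rightarrow> nat \<Rightarrow> bool list" where
  "code_word j n k = query_word (code_prefix j) n k"

lemma replicate_True_False_inject:
  "replicate i True @ False # v = replicate j True @ False # w \<longleftrightarrow> i = j \<and> v = w"
proof (induction i arbitrary: j)
  case 0 then show ?case by (cases j) auto
next
  case (Suc i) then show ?case by (cases j) auto
qed

lemma code_word_inject:
  "code_word j n k = code_word j' n' k' \<longleftrightarrow> j = j' \<and> n = n' \<and> k = k'"
proof -
  have "code_word j n k = True # replicate j True @ False # replicate n True @ False # replicate k True"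
      for j n k
    by (simp add: code_word_def query_word_def code_prefix_def)
  then show ?thesis
    by (simp add: replicate_True_False_inject)
qed

text \<open>The \<open>Suc\<close> in \<open>code_prefix\<close> provides a leading
  \<open>True\<close> even for \<open>j = 0\<close>, which keeps code words apart from words taken
  from \<open>A\<close>.\<close>

lemma hd_code_word: "hd (code_word j n k)"
  by (simp add: code_word_def query_word_def code_prefix_def)

lemma length_code_word: "length (code_word j n k) = j + n + k + 3"
  by (simp add: code_word_def query_word_def code_prefix_def)

text \<open>
  The reader for program j receives a word of 2q bits, where q = poly p n. The leading q of them are
  zero, so that all informative queries are longer than any query of the program itself.
\<close>

definition code_bit :: "language \<Rightarrow> nat \<Rightarrow> nat \<Rightarrow> nat \<Rightarrow> bool" where
  "code_bit D j n k = (case program j of (M, p, s) \<Rightarrow> let q = poly p n in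
     if even k then q \<le> k div 2 \<and> k div 2 < 2 * q \<and>
                    bit (card (accepting_paths M D (replicate n s))) (2 * q - 1 - k div 2)
     else k = 4 * q - 1)"

section \<open>Recursion on word length\<close>

definition member_rule :: "language \<Rightarrow> language \<Rightarrow> bool list \<Rightarrow> bool" where
  "member_rule A D w \<longleftrightarrow>
     (\<exists>v. w = False # v \<and> w \<in> A) \<or> (\<exists>j n k. w = code_word j n k \<and> code_bit D j n k)"

text \<open>Stage \<open>l\<close> settles the words shorter than \<open>l\<close>. A word of length
  \<open>l\<close> may encode only computations with this truncated oracle;
  \<open>reader_output\<close> shows that the truncation does no harm.\<close>

primrec coded_below :: "language \<Rightarrow> nat \<Rightarrow> language" where
  "coded_below A 0 = {}"
| "coded_below A (Suc l) = coded_below A l \<union> {w. length w = l \<and> member_rule A (coded_below A l) w}"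

definition coded :: "language \<Rightarrow> language" where
  "coded A = (\<Union>l. coded_below A l)"

lemma coded_below_iff:
  "w \<in> coded_below A l \<longleftrightarrow> length w < l \<and> member_rule A (coded_below A (length w)) w"
  by (induction l) (auto simp: less_Suc_eq)

lemma in_coded_iff: "w \<in> coded A \<longleftrightarrow> member_rule A (coded_below A (length w)) w"
  by (auto simp: coded_def coded_below_iff)

lemma coded_below_eq: "coded_below A l = {w \<in> coded A. length w < l}"
  by (auto simp: in_coded_iff coded_below_iff[of _ A l])

lemma False_Cons_in_coded: "False # v \<in> coded A \<longleftrightarrow> False # v \<in> A"
  using hd_code_word by (force simp: in_coded_iff member_rule_def dest: arg_cong[of _ _ hd])

lemma code_word_in_coded:
  "code_word j n k \<in> coded A \<longleftrightarrow> code_bit (coded_below A (length (code_word j n k))) j n k"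
proof -
  have "code_word j n k \<noteq> False # v" for v using hd_code_word[of j n k] by auto
  then show ?thesis by (auto simp: in_coded_iff member_rule_def code_word_inject)
qed

lemma coded_cases:
  assumes "w \<in> coded A"
  obtains v where "w = False # v" "w \<in> A" | j n k where "w = code_word j n k"
  using assms by (auto simp: in_coded_iff member_rule_def)

lemma coded_below_cong:
  assumes "\<And>w. length w < l \<Longrightarrow> w \<in> A \<longleftrightarrow> w \<in> A'"
  shows "coded_below A l = coded_below A' l"
  using assms
proof (induction l)
  case (Suc l)
  then have "coded_below A l = coded_below A' l" by simp
  moreover have "member_rule A D w \<longleftrightarrow> member_rule A' D w" if "length w = l" for D w
    using Suc.prems[of w] that by (simp add: member_rule_def)
  ultimately show ?case by auto
qed simp

text \<open>Fixing \<open>A\<close> up to length \<open>l\<close> fixes the oracle up to length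
  \<open>l\<close>, so the diagonalization can make its commitments in terms of
  \<open>A\<close>.\<close>

lemma coded_cong:
  assumes "\<And>w. length w \<le> l \<Longrightarrow> w \<in> A \<longleftrightarrow> w \<in> A'" "length w \<le> l"
  shows "w \<in> coded A \<longleftrightarrow> w \<in> coded A'"
  using coded_below_cong[of "Suc l" A A'] assms unfolding coded_below_eq by auto

section \<open>The reader computes the number of accepting paths\<close>

lemma reader_output:
  assumes j: "program j = (M, p, s)" and s: "s \<noteq> Blank" and M: "wf_otm M"
    and time: "time_bounded M (coded A) (init M (replicate n s)) (poly p n)"
    and pos: "0 < poly p n"
    and small: "card (accepting_paths M (coded A) (replicate n s)) < 2 ^ poly p n"
  defines "N \<equiv> reader s (code_prefix j)"
  shows "outputs N (coded A) (replicate n s) (card (accepting_paths M (coded A) (replicate n s)))"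
    and "time_bounded N (coded A) (init N (replicate n s)) (j + n + 6 + 8 * poly p n)"
proof -
  define q where "q = poly p n"
  define a where "a = card (accepting_paths M (coded A) (replicate n s))"
  define D where "D = coded A"
  let ?u = "code_prefix j"
  have lu: "length ?u = j + 2" by (simp add: code_prefix_def)
  \<comment> \<open>The stop query \<open>4 * q - 1\<close> is \<open>2 * i + 1\<close> for
    \<open>i = 2 * q - 1\<close>; as \<open>q\<close> is positive, the subtractions are
    exact.\<close>
  have odd: "query_word ?u n (2 * i + 1) \<in> D \<longleftrightarrow> i = 2 * q - 1" for i
    using pos unfolding D_def code_word_def[symmetric] code_word_in_coded
    by (auto simp: code_bit_def j Let_def q_def)
  have even: "query_word ?u n (2 * i) \<in> D \<longleftrightarrow> bit a (2 * q - 1 - i)" if "i < 2 * q" for i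
  proof (cases "q \<le> i")
    case True
    \<comment> \<open>The code word has length \<open>j + n + 2 * i + 3\<close>, which exceeds
      \<open>q\<close> and hence every query of \<open>M\<close>, so truncating the oracle there
      leaves the paths unchanged.\<close>
    have "accepting_paths M (coded A) (replicate n s) =
        accepting_paths M (coded_below A (length (code_word j n (2 * i)))) (replicate n s)"
      by (rule accepting_paths_cong[OF M _ time])
        (use True in \<open>auto simp: coded_below_eq length_code_word q_def\<close>)
    then show ?thesis
      using True that unfolding D_def code_word_def[symmetric] code_word_in_coded
      by (simp add: code_bit_def j Let_def q_def a_def)
  next
    case False
    \<comment> \<open>The first \<open>q\<close> output positions stand for bits number
      \<open>q\<close> and above, which vanish because \<open>a < 2 ^ q\<close>.\<close>
    have "a < 2 ^ q" using small by (simp add: a_def q_def)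
    also have "\<dots> \<le> 2 ^ (2 * q - 1 - i)" using False by (intro power_increasing) auto
    finally have "a < 2 ^ (2 * q - 1 - i)" .
    then have "\<not> bit a (2 * q - 1 - i)" by (simp add: bit_iff_odd)
    then show ?thesis
      using False unfolding D_def code_word_def[symmetric] code_word_in_coded
      by (simp add: code_bit_def j Let_def q_def)
  qed
  have q0: "Suc (2 * q - 1) = 2 * q" using pos by (simp add: q_def)
  let ?w = "map (\<lambda>i. query_word ?u n (2 * i) \<in> D) [0..<2 * q]"
  obtain c where c: "(step N D ^^ (length ?u + n + 4 + 4 * (2 * q - 1))) (init N (replicate n s)) c"
      "halted N D c" "holds_word (snd c ! 2) ?w"
    using reader_final[OF s, of "2 * q - 1" ?u n D] odd unfolding N_def q0 by auto
  \<comment> \<open>Output is most significant bit first: position \<open>i\<close> holds bit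
    \<open>2 * q - 1 - i\<close>.\<close>
  have "rev ?w = map (bit a) [0..<2 * q]"
    by (rule nth_equalityI) (auto simp: rev_nth even)
  then have "binary_value ?w = take_bit (2 * q) a"
    by (simp add: binary_value_def horner_sum_bit_eq_take_bit)
  also have "\<dots> = a"
  proof -
    have "a < 2 ^ q" using small by (simp add: a_def q_def)
    also have "\<dots> \<le> 2 ^ (2 * q)" by (intro power_increasing) auto
    finally show ?thesis by (simp add: take_bit_nat_eq_self_iff)
  qed
  finally have "outputs N D (replicate n s) a"
    unfolding outputs_def using relpowp_imp_rtranclp[OF c(1)] c(2,3) by blast
  then show "outputs N (coded A) (replicate n s) (card (accepting_paths M (coded A) (replicate n s)))"
    by (simp only: D_def a_def)
  have "time_bounded N D (init N (replicate n s)) (length ?u + n + 4 + 4 * (2 * q - 1))"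
    using c deterministic_reader[OF s] unfolding N_def by (intro time_bounded_deterministic) auto
  then show "time_bounded N (coded A) (init N (replicate n s)) (j + n + 6 + 8 * poly p n)"
    unfolding time_bounded_def D_def lu q_def by fastforce
qed

lemma sharpP1_coded_subset: "sharpP1 (coded A) \<subseteq> FP (coded A)"
proof
  fix f assume "f \<in> sharpP1 (coded A)"
  then obtain S where S: "input_alphabet S" "card S = 1" "f \<in> sharpP_over S (coded A)"
    by (auto simp: sharpP1_def)
  then obtain s where s: "S = {s}" "s \<noteq> Blank" by (auto simp: card_1_singleton_iff input_alphabet_def)
  have f: "dom f = lists S" using S(3) by (simp add: sharpP_over_def)
  from S(3) obtain M where M: "wf_otm M" and pt: "poly_time M (coded A) S"
    and fx: "\<And>x. x \<in> lists S \<Longrightarrow> f x = Some (card (accepting_paths M (coded A) x))"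
    unfolding sharpP_over_def by blast
  from pt obtain p where
      p: "\<And>x t c. x \<in> lists S \<Longrightarrow> (step M (coded A) ^^ t) (init M x) c \<Longrightarrow> t \<le> poly p (length x)"
    unfolding poly_time_def by blast
  define B where "B = Suc (card (transitions M))"
  \<comment> \<open>\<open>r\<close> has to bound the running time and the number of bits of a path
    count, which is at most \<open>B ^ p\<close>; the \<open>1\<close> makes it positive and the
    bound on the count strict.\<close>
  define r where "r = smult B p + p + 1"
  have r: "poly r n = B * poly p n + poly p n + 1" for n by (simp add: r_def)
  obtain j where j: "program j = (M, r, s)" using program_surj[OF M] by blast
  let ?N = "reader s (code_prefix j)"
  have uni: "replicate n s \<in> lists S" for n by (auto simp: s)
  have tb: "time_bounded M (coded A) (init M (replicate n s)) (poly p n)" for n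
    unfolding time_bounded_def using p[OF uni[of n]] by simp
  have tb': "time_bounded M (coded A) (init M (replicate n s)) (poly r n)" for n
    using tb[of n] unfolding time_bounded_def r by fastforce
  have small: "card (accepting_paths M (coded A) (replicate n s)) < 2 ^ poly r n" for n
  proof -
    have "card (accepting_paths M (coded A) (replicate n s)) \<le> B ^ poly p n"
      unfolding accepting_paths_eq B_def using paths_from_finite[OF M tb] by blast
    also have "\<dots> \<le> (2 ^ B) ^ poly p n"
      by (intro power_mono) (simp_all add: less_imp_le[OF less_exp])
    also have "\<dots> = 2 ^ (B * poly p n)" by (simp add: power_mult)
    also have "\<dots> < 2 ^ poly r n" unfolding r by (intro power_strict_increasing) auto
    finally show ?thesis .
  qed
  note out = reader_output[OF j s(2) M tb' _ small]
  have words: "\<exists>n. x = replicate n s \<and> length x = n" if "x \<in> lists S" for x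
    using that by (intro exI[of _ "length x"])
      (auto simp: s lists_eq_set intro!: replicate_length_same[symmetric])
  have "poly_time ?N (coded A) S"
    unfolding poly_time_def
  proof (intro exI ballI allI impI)
    fix x t c assume x: "x \<in> lists S" and t: "(step ?N (coded A) ^^ t) (init ?N x) c"
    obtain n where n: "x = replicate n s" using words[OF x] by blast
    have "t \<le> j + n + 6 + 8 * poly r n"
    proof -
      have "time_bounded ?N (coded A) (init ?N (replicate n s)) (j + n + 6 + 8 * poly r n)"
        by (rule out(2)) (simp add: r)
      then show ?thesis using t unfolding time_bounded_def n by blast
    qed
    then show "t \<le> poly ([:j + 6, 1:] + smult 8 r) (length x)" by (simp add: n)
  qed
  moreover have "\<exists>m. f x = Some m \<and> outputs ?N (coded A) x m" if x: "x \<in> lists S" for x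
    using words[OF x] out(1) fx[OF x] r by fastforce
  ultimately have "f \<in> FP_over S (coded A)"
    unfolding FP_over_def using f wf_reader deterministic_reader[OF s(2)] by blast
  then show "f \<in> FP (coded A)" unfolding FP_def using S(1) by blast
qed

section \<open>Diagonalization\<close>

text \<open>With the clock built in, success at length \<open>n\<close> depends on a finite part of
  the oracle only.\<close>

definition solves :: "otm \<Rightarrow> nat poly \<Rightarrow> language \<Rightarrow> nat \<Rightarrow> bool" where
  "solves M p D n \<longleftrightarrow> (\<forall>x. length x = n \<longrightarrow>
     time_bounded M D (init M (map Bit x)) (poly p n) \<and> outputs M D (map Bit x) (block_count D x))"

text \<open>The limit \<open>t\<close> allows outputs to be transferred to oracles for which no time
  bound on \<open>M\<close> is known.\<close>

definition outputs_within :: "otm \<Rightarrow> language \<Rightarrow> symbol list \<Rightarrow> nat \<Rightarrow> nat \<Rightarrow> bool" where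
  "outputs_within M D x t v \<longleftrightarrow>
     (\<exists>i \<le> t. \<exists>c w. (step M D ^^ i) (init M x) c \<and> halted M D c \<and>
        holds_word (snd c ! 2) w \<and> binary_value w = v)"

lemma outputs_within_iff:
  assumes "time_bounded M D (init M x) t"
  shows "outputs_within M D x t v \<longleftrightarrow> outputs M D x v"
  using assms unfolding outputs_within_def outputs_def time_bounded_def rtranclp_power by blast

lemma outputs_within_cong:
  assumes "\<And>i c. i \<le> t \<Longrightarrow> (step M D ^^ i) (init M x) c \<longleftrightarrow> (step M E ^^ i) (init M x) c"
  shows "outputs_within M D x t v \<longleftrightarrow> outputs_within M E x t v"
  unfolding outputs_within_def using assms halted_oracle_irrelevant[of M D _ E] by blast

lemma outputs_within_unique:
  assumes "deterministic M" "outputs_within M D x t v" "outputs_within M D x t v'"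
  shows "v = v'"
proof -
  obtain i c w where 1: "(step M D ^^ i) (init M x) c" "halted M D c" "holds_word (snd c ! 2) w"
      "binary_value w = v"
    using assms(2) unfolding outputs_within_def by blast
  obtain i' c' w' where 2: "(step M D ^^ i') (init M x) c'" "halted M D c'" "holds_word (snd c' ! 2) w'"
      "binary_value w' = v'"
    using assms(3) unfolding outputs_within_def by blast
  \<comment> \<open>Each halting time bounds all runs, hence also the other halting time.\<close>
  have "i = i'"
    using time_bounded_deterministic[OF assms(1) 1(1,2)] time_bounded_deterministic[OF assms(1) 2(1,2)]
        1(1) 2(1)
    unfolding time_bounded_def by (meson antisym)
  then have "c = c'" using deterministic_relpowp[OF assms(1)] 1(1) 2(1) by blast
  then show ?thesis using 1 2 holds_word_unique by blast
qed

lemma block_word_inject: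
  assumes "length x = length y" "length x' = length y'"
  shows "block_word x y = block_word x' y' \<longleftrightarrow> x = x' \<and> y = y'"
  using interleave_inject[OF assms] by (auto simp: block_word_def)

lemma length_block_word: "length x = length y \<Longrightarrow> length (block_word x y) = Suc (2 * length x)"
  by (simp add: block_word_def length_interleave)

text \<open>\<open>l\<close> must cover both the queries of \<open>M\<close> and the block words
  being counted, which have length \<open>2 * n + 1\<close>.\<close>

lemma solves_cong:
  assumes "wf_otm M" "\<And>w. length w \<le> l \<Longrightarrow> w \<in> D \<longleftrightarrow> w \<in> E" "poly p n \<le> l" "Suc (2 * n) \<le> l"
    and "solves M p D n"
  shows "solves M p E n"
  unfolding solves_def
proof (intro allI impI conjI)
  fix x :: "bool list" assume x: "length x = n"
  have tb: "time_bounded M D (init M (map Bit x)) (poly p n)"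
    and out: "outputs M D (map Bit x) (block_count D x)" using assms(5) x by (auto simp: solves_def)
  have ag: "\<And>w. length w \<le> poly p n \<Longrightarrow> w \<in> D \<longleftrightarrow> w \<in> E"
      using assms(2,3) by auto
  show tb': "time_bounded M E (init M (map Bit x)) (poly p n)"
    by (rule time_bounded_init_cong[OF assms(1) ag tb])
  have "block_word x y \<in> D \<longleftrightarrow> block_word x y \<in> E" if "length y = length x" for y
    using assms(2,4) x that by (simp add: length_block_word)
  then have "block_count D x = block_count E x"
    unfolding block_count_def by (metis (lifting))
  moreover have "outputs_within M D (map Bit x) (poly p n) v \<longleftrightarrow>
      outputs_within M E (map Bit x) (poly p n) v" for v
    by (rule outputs_within_cong, rule relpowp_init_cong[OF assms(1) ag]) auto
  ultimately show "outputs M E (map Bit x) (block_count E x)"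
    using out outputs_within_iff[OF tb] outputs_within_iff[OF tb'] by simp
qed

section \<open>Levels, advice and queried words\<close>

definition block_level :: "nat \<Rightarrow> language" where
  "block_level n = (\<lambda>(x, y). block_word x y) ` ({x. length x = n} \<times> {y. length y = n})"

definition code_words :: "nat \<Rightarrow> language" where
  "code_words t = {w. length w \<le> t \<and> (\<exists>j n k. w = code_word j n k)}"

text \<open>A code word is determined by three numbers, each at most its length.\<close>

lemma card_code_words: "finite (code_words t)" "card (code_words t) \<le> (t + 1) ^ 3"
proof -
  have sub: "code_words t \<subseteq> (\<lambda>(j, n, k). code_word j n k) ` ({..t} \<times> {..t} \<times> {..t})"
    by (force simp: code_words_def length_code_word image_iff)
  then show "finite (code_words t)" by (rule finite_subset) auto
  have "card (code_words t) \<le> card ({..t} \<times> {..t} \<times> {..t})"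
    using sub by (intro surj_card_le) auto
  then show "card (code_words t) \<le> (t + 1) ^ 3"
    by (simp add: power3_eq_cube card_cartesian_product algebra_simps)
qed

lemma card_bool_lists: "card {x :: bool list. length x = n} = 2 ^ n"
  using card_lists_length_eq[of "UNIV :: bool set" n] by simp

lemma finite_bool_lists: "finite {x :: bool list. length x = n}"
  using finite_lists_length[of n "\<lambda>_. True"] by simp

text \<open>Every word standing on the query tape is included, asked or not; a deterministic machine
  still contributes at most one for each input and time.\<close>

definition queried :: "otm \<Rightarrow> bool list set \<Rightarrow> nat \<Rightarrow> language \<Rightarrow> language" where
  "queried M X t D = {w. \<exists>x\<in>X. \<exists>i\<le>t. \<exists>c. (step M D ^^ i) (init M (map Bit x)) c \<and> holds_word (snd c ! 1) w}"

lemma card_queried: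
  assumes "deterministic M" "finite X"
  shows "finite (queried M X t D) \<and> card (queried M X t D) \<le> card X * (t + 1)"
proof -
  let ?g = "\<lambda>(x, i). THE w. \<exists>c. (step M D ^^ i) (init M (map Bit x)) c \<and> holds_word (snd c ! 1) w"
  have sub: "queried M X t D \<subseteq> ?g ` (X \<times> {..t})"
  proof
    fix w assume "w \<in> queried M X t D"
    then obtain x i c where x: "x \<in> X" "i \<le> t" and c: "(step M D ^^ i) (init M (map Bit x)) c"
        "holds_word (snd c ! 1) w"
      by (auto simp: queried_def)
    have "?g (x, i) = w"
      unfolding prod.case
    proof (rule the_equality)
      show "\<exists>c. (step M D ^^ i) (init M (map Bit x)) c \<and> holds_word (snd c ! 1) w"
          using c by blast
    next
      fix v assume "\<exists>c. (step M D ^^ i) (init M (map Bit x)) c \<and> holds_word (snd c ! 1) v"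
      then show "v = w" using c deterministic_relpowp[OF assms(1)] holds_word_unique by blast
    qed
    then show "w \<in> ?g ` (X \<times> {..t})" using x by (intro image_eqI[of _ _ "(x, i)"]) auto
  qed
  have fin: "finite (X \<times> {..t})" using assms(2) by simp
  show ?thesis
    using finite_subset[OF sub finite_imageI[OF fin]] surj_card_le[OF fin sub]
    by (simp add: card_cartesian_product)
qed

lemma queried_agree:
  assumes "\<And>w. w \<in> queried M X t D \<Longrightarrow> w \<in> D \<longleftrightarrow> w \<in> E" "x \<in> X" "i \<le> t"
  shows "(step M D ^^ i) (init M (map Bit x)) c \<longleftrightarrow> (step M E ^^ i) (init M (map Bit x)) c"
proof (rule relpowp_step_cong[of t, OF _ assms(3)])
  fix i c w assume "i < t" "(step M D ^^ i) (init M (map Bit x)) c" "holds_word (snd c ! 1) w"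
  then have "w \<in> queried M X t D" unfolding queried_def using assms(2) less_imp_le by blast
  then show "w \<in> D \<longleftrightarrow> w \<in> E" by (rule assms(1))
qed

text \<open>Changes outside the queried set do not affect the runs, so this set can be recovered
  from the changed oracle.\<close>

lemma queried_eq:
  assumes "\<And>w. w \<in> queried M X t D \<Longrightarrow> w \<in> D \<longleftrightarrow> w \<in> E"
  shows "queried M X t D = queried M X t E"
  unfolding queried_def using queried_agree[of M X t D E] assms by blast

text \<open>Flipping one element changes the size by one; thus block sizes reveal which blocks were
  flipped.\<close>

lemma card_symdiff_singleton:
  assumes "finite S"
  shows "card (sym_diff S {y}) \<noteq> card S"
proof (cases "y \<in> S")
  case True
  then have "sym_diff S {y} = S - {y}" by auto
  then show ?thesis using True assms by (metis card_Diff1_less less_irrefl)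
next
  case False
  then have "sym_diff S {y} = insert y S" by auto
  then show ?thesis using False assms by simp
qed

text \<open>
  If a machine were correct on level n for every choice B of that level, then B and a set Z of inputs
  could be recovered from the advice C B and the level obtained from B by flipping one unqueried word
  in each block of Z: the machine does not notice the flips, so its outputs still are the block sizes
  of B, and these tell which blocks were flipped. But there are more sets Z than values of C B.
\<close>

lemma exists_hard_level:
  assumes M: "wf_otm M" "deterministic M"
    and big: "((poly p n + 1) ^ 3 + 1) * (poly p n + 1) < 2 ^ n"
  shows "\<exists>B \<subseteq> block_level n. \<not> solves M p (coded (A - block_level n \<union> B)) n"
proof (rule ccontr)
  define t where "t = poly p n"
  define U where "U = block_level n"
  define K where "K = card (code_words t)"
  assume "\<not> ?thesis"
  then have sol: "solves M p (coded (A - U \<union> B)) n" if "B \<subseteq> U" for B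
    using that by (auto simp: U_def)
  have big': "((t + 1) ^ 3 + 1) * (t + 1) < 2 ^ n" using big by (simp add: t_def)
  have K: "K \<le> (t + 1) ^ 3" unfolding K_def by (rule card_code_words)
  have KX: "(K + 1) * (t + 1) < 2 ^ n"
  proof -
    have "(K + 1) * (t + 1) \<le> ((t + 1) ^ 3 + 1) * (t + 1)" by (rule mult_right_mono) (use K in auto)
    then show ?thesis using big' by linarith
  qed
  moreover have "K + 1 \<le> (K + 1) * (t + 1)" by simp
  ultimately have "K + 1 \<le> card {x :: bool list. length x = n}"
    unfolding card_bool_lists by linarith
  \<comment> \<open>A set of \<open>K + 1\<close> inputs has twice as many subsets as there are
    subsets of \<open>code_words t\<close>, the possible values of \<open>C B\<close>.\<close>
  then obtain X where X: "X \<subseteq> {x :: bool list. length x = n}" "card X = K + 1" "finite X"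
    by (rule obtain_subset_with_card_n)
  define C where "C B = coded (A - U \<union> B) \<inter> code_words t" for B
  \<comment> \<open>\<open>E B (C B)\<close> agrees with \<open>coded (A - U \<union> B)\<close> on
    words of length at most \<open>t\<close>. Level and advice are separate arguments, so that the
    level can be flipped with the advice kept.\<close>
  define E where "E B a = {w \<in> A - U \<union> B. \<exists>v. w = False # v} \<union> a" for B a
  \<comment> \<open>The choice depends on the queried set alone, so it can be repeated from the
    flipped level.\<close>
  define pick where "pick Q x = (SOME y. length y = n \<and> block_word x y \<notin> Q)" for Q x
  define flips where "flips Q Z = (\<lambda>x. block_word x (pick Q x)) ` Z" for Q Z
  define T where "T B = queried M X t (E B (C B))" for B
  define F where "F B Z = sym_diff B (flips (T B) Z)" for B Z

  have len: "length x = n" if "x \<in> X" for x using X that by auto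
  have pick: "length (pick (T B) x) = n \<and> block_word x (pick (T B) x) \<notin> T B" if x: "x \<in> X" for B x
  proof -
    have inj: "inj_on (block_word x) {y. length y = n}"
      by (rule inj_onI) (use len[OF x] block_word_inject in auto)
    \<comment> \<open>The runs on all inputs in \<open>X\<close> together query fewer words than a
      single block contains.\<close>
    have "card (T B) < 2 ^ n"
      using card_queried[OF M(2) X(3), of t "E B (C B)"] KX X(2) unfolding T_def by simp
    then have "\<not> block_word x ` {y. length y = n} \<subseteq> T B"
      using card_mono[of "T B" "block_word x ` {y. length y = n}"] card_image[OF inj] card_bool_lists[of n]
        card_queried[OF M(2) X(3), of t "E B (C B)"] unfolding T_def by auto
    then have "\<exists>y. length y = n \<and> block_word x y \<notin> T B" by blast
    then show ?thesis unfolding pick_def by (rule someI_ex)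
  qed
  have flips_U: "flips (T B) Z \<subseteq> U" if ZX: "Z \<subseteq> X" for B Z
  proof
    fix w assume "w \<in> flips (T B) Z"
    then obtain x where "x \<in> X" "w = block_word x (pick (T B) x)"
      using ZX unfolding flips_def by blast
    then show "w \<in> U" using pick len unfolding U_def block_level_def by force
  qed
  have flips_T: "flips (T B) Z \<inter> T B = {}" if "Z \<subseteq> X" for B Z
    using that pick by (auto simp: flips_def)
  have FU: "F B Z \<subseteq> U" if "B \<subseteq> U" "Z \<subseteq> X" for B Z
    using flips_U[OF that(2), of B] that(1) by (auto simp: F_def)
  have T_F: "w \<in> E B (C B) \<longleftrightarrow> w \<in> E (F B Z) (C B)" if "B \<subseteq> U" "Z \<subseteq> X" "w \<in> T B" for B Z w
    using flips_T[OF that(2), of B] that(3) by (auto simp: F_def E_def)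
  have out: "outputs_within M (E (F B Z) (C B)) (map Bit x) t (block_count B x)"
    if B: "B \<subseteq> U" and Z: "Z \<subseteq> X" and x: "x \<in> X" for B Z x
  proof -
    let ?D = "coded (A - U \<union> B)"
    have tb: "time_bounded M ?D (init M (map Bit x)) t"
      and "outputs M ?D (map Bit x) (block_count ?D x)"
      using sol[OF B] len[OF x] by (auto simp: solves_def t_def)
    then have 1: "outputs_within M ?D (map Bit x) t (block_count ?D x)"
      by (simp add: outputs_within_iff)
    have "block_word x y \<in> ?D \<longleftrightarrow> block_word x y \<in> B" if "length y = length x" for y
    proof -
      have "block_word x y \<in> U" using that len[OF x] unfolding U_def block_level_def by force
      then show ?thesis by (auto simp: block_word_def False_Cons_in_coded)
    qed
    then have 2: "block_count ?D x = block_count B x" unfolding block_count_def by (metis (lifting))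
    have ag: "w \<in> ?D \<longleftrightarrow> w \<in> E B (C B)" if "length w \<le> t" for w
    proof
      assume w: "w \<in> ?D"
      then show "w \<in> E B (C B)"
        by (rule coded_cases) (use that w in \<open>auto simp: E_def C_def code_words_def\<close>)
    next
      assume "w \<in> E B (C B)"
      then show "w \<in> ?D" by (auto simp: E_def C_def False_Cons_in_coded)
    qed
    have 3: "outputs_within M ?D (map Bit x) t v \<longleftrightarrow> outputs_within M (E B (C B)) (map Bit x) t v" for v
      by (rule outputs_within_cong, rule relpowp_init_cong[OF M(1) ag]) auto
    have 4: "outputs_within M (E B (C B)) (map Bit x) t v \<longleftrightarrow>
        outputs_within M (E (F B Z) (C B)) (map Bit x) t v" for v
      by (rule outputs_within_cong, rule queried_agree[of M X])
        (use T_F[OF B Z] x in \<open>auto simp: T_def\<close>)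
    show ?thesis using 1 2 3 4 by simp
  qed
  \<comment> \<open>The flipped level and the advice determine \<open>T B\<close>, and hence the
    positions of all possible flips.\<close>
  have TE: "T B = queried M X t (E (F B Z) (C B))" if "B \<subseteq> U" "Z \<subseteq> X" for B Z
    unfolding T_def by (rule queried_eq) (use T_F[OF that] in \<open>auto simp: T_def\<close>)

  have block_flip: "{y. length y = length x \<and> block_word x y \<in> sym_diff B' (flips Q Z)} =
      (if x \<in> Z then sym_diff {y. length y = length x \<and> block_word x y \<in> B'} {pick Q x}
       else {y. length y = length x \<and> block_word x y \<in> B'})"
    if Z: "Z \<subseteq> X" and x: "x \<in> X" and Q: "Q = T B" for B' Q Z x B
  proof -
    have "block_word x y \<in> flips Q Z \<longleftrightarrow> x \<in> Z \<and> y = pick Q x" if "length y = length x" for y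
    proof -
      have "block_word x y = block_word x' (pick Q x') \<longleftrightarrow> x = x' \<and> y = pick Q x'" if "x' \<in> Z" for x'
        using \<open>length y = length x\<close> pick[of x' B] len[of x'] Z that Q
            by (intro block_word_inject) auto
      then show ?thesis by (auto simp: flips_def image_iff)
    qed
    moreover have "length (pick Q x) = length x" using pick[OF x] len[OF x] Q by simp
    ultimately show ?thesis by auto
  qed

  have "inj_on (\<lambda>(B, Z). (F B Z, C B)) (Pow U \<times> Pow X)"
  proof (rule inj_onI, clarify)
    fix B1 Z1 B2 Z2
    assume s: "B1 \<subseteq> U" "Z1 \<subseteq> X" "B2 \<subseteq> U" "Z2 \<subseteq> X" and eq: "F B1 Z1 = F B2 Z2" "C B1 = C B2"
    define B' Q where "B' = F B1 Z1" and "Q = T B1"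
    have Q: "Q = T B2" using TE[OF s(1,2)] TE[OF s(3,4)] eq by (simp add: Q_def)
    have "B' = sym_diff B1 (flips Q Z1)" by (simp only: B'_def F_def Q_def)
    \<comment> \<open>Symmetric difference is an involution: flipping again restores
      \<open>B1\<close>.\<close>
    then have B1: "B1 = sym_diff B' (flips Q Z1)" by blast
    have "B' = sym_diff B2 (flips Q Z2)" by (simp only: B'_def eq(1)) (simp only: F_def Q)
    then have B2: "B2 = sym_diff B' (flips Q Z2)" by blast
    have "x \<in> Z1 \<longleftrightarrow> x \<in> Z2" if x: "x \<in> X" for x
    proof -
      \<comment> \<open>Both are outputs of the deterministic machine \<open>M\<close> on
        \<open>x\<close> with the same oracle \<open>E B' (C B1)\<close>.\<close>
      have "block_count B1 x = block_count B2 x"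
        using outputs_within_unique[OF M(2)] out[OF s(1,2) x] out[OF s(3,4) x] eq by metis
      moreover define S where "S = {y. length y = length x \<and> block_word x y \<in> B'}"
      moreover have "block_count B1 x = card (if x \<in> Z1 then sym_diff S {pick Q x} else S)"
        unfolding block_count_def S_def block_flip[OF s(2) x Q_def, symmetric] using B1 by simp
      moreover have "block_count B2 x = card (if x \<in> Z2 then sym_diff S {pick Q x} else S)"
        unfolding block_count_def S_def block_flip[OF s(4) x Q_def, symmetric] using B2 by simp
      moreover have "card (sym_diff S {pick Q x}) \<noteq> card S"
        unfolding S_def by (rule card_symdiff_singleton) (rule finite_lists_length)
      ultimately show ?thesis by presburger
    qed
    then have "Z1 = Z2" using s by blast
    then show "B1 = B2 \<and> Z1 = Z2" using B1 B2 by simp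
  qed
  moreover have finU: "finite U" unfolding U_def block_level_def
    using finite_bool_lists[of n] by simp
  moreover have "(\<lambda>(B, Z). (F B Z, C B)) ` (Pow U \<times> Pow X) \<subseteq> Pow U \<times> Pow (code_words t)"
  proof
    fix z assume "z \<in> (\<lambda>(B, Z). (F B Z, C B)) ` (Pow U \<times> Pow X)"
    then obtain B Z where "B \<subseteq> U" "Z \<subseteq> X" "z = (F B Z, C B)" by auto
    then show "z \<in> Pow U \<times> Pow (code_words t)" using FU by (auto simp: C_def)
  qed
  ultimately have "card (Pow U \<times> Pow X) \<le> card (Pow U \<times> Pow (code_words t))"
    by (intro card_inj_on_le) (simp_all add: card_code_words)
  then have "(2::nat) ^ card U * 2 ^ (K + 1) \<le> 2 ^ card U * 2 ^ K"
    using finU X card_code_words(1) by (simp add: card_cartesian_product card_Pow K_def)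
  then show False by simp
qed

section \<open>Polynomials against powers of two\<close>

lemma poly_bounded_by_power: "\<exists>c d. \<forall>n. poly (p :: nat poly) n \<le> c * (n + 1) ^ d"
proof (induction p)
  case 0
  then show ?case by simp
next
  case (pCons a p)
  then obtain c d where cd: "\<And>n. poly p n \<le> c * (n + 1) ^ d" by blast
  have "poly (pCons a p) n \<le> (a + c) * (n + 1) ^ Suc d" for n
  proof -
    have "n * poly p n \<le> (n + 1) * (c * (n + 1) ^ d)" by (intro mult_mono cd) auto
    moreover have "a * 1 \<le> a * (n + 1) ^ Suc d" by (intro mult_left_mono one_le_power) auto
    ultimately show ?thesis by (simp add: algebra_simps)
  qed
  then show ?case by blast
qed

lemma linear_below_two_power: "\<exists>m \<ge> l. a * m + b < (2 :: nat) ^ m"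
proof -
  \<comment> \<open>With \<open>s = a + b + l + 1\<close> the chain is
    \<open>a * m + b < 2 * s * s \<le> 2 ^ (2 * s)\<close>.\<close>
  define m where "m = 2 * (a + b + l + 1)"
  have "a * m + b < (a + b + l + 1) * (a + b + l + 1) * 2"
    by (simp add: m_def algebra_simps)
  also have "\<dots> \<le> 2 ^ (a + b + l) * 2 ^ (a + b + l + 1) * 2"
  proof (intro mult_mono)
    show S: "a + b + l + 1 \<le> 2 ^ (a + b + l)" using less_exp[of "a + b + l"] by linarith
    show "a + b + l + 1 \<le> 2 ^ (a + b + l + 1)" using less_exp[of "a + b + l + 1"] by linarith
  qed auto
  also have "\<dots> = 2 ^ ((a + b + l) + (a + b + l + 1) + 1)"
    by (simp only: power_add power_one_right)
  also have "(a + b + l) + (a + b + l + 1) + 1 = m" by (simp add: m_def)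
  finally show ?thesis by (intro exI[of _ m]) (simp add: m_def)
qed

text \<open>At \<open>n = 2 ^ m\<close> a polynomial is at most 2 to a power linear in
  \<open>m\<close>, and this exponent is eventually below \<open>2 ^ m\<close>.\<close>

lemma poly_below_two_power: "\<exists>n \<ge> l. poly (p :: nat poly) n < 2 ^ n"
proof -
  obtain c d where cd: "\<And>n. poly p n \<le> c * (n + 1) ^ d" using poly_bounded_by_power by blast
  obtain m where m: "m \<ge> l" "d * m + (c + d) < 2 ^ m" using linear_below_two_power by blast
  have "poly p (2 ^ m) \<le> c * (2 ^ m + 1) ^ d" by (rule cd)
  also have "\<dots> \<le> 2 ^ c * (2 ^ (m + 1)) ^ d"
    by (intro mult_mono power_mono) (auto simp: less_imp_le[OF less_exp])
  also have "\<dots> = 2 ^ (d * m + (c + d))"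
    by (simp add: power_add[symmetric] power_mult[symmetric] algebra_simps)
  also have "\<dots> < 2 ^ 2 ^ m" using m(2) by (intro power_strict_increasing) auto
  finally show ?thesis using m(1) less_exp[of m] by (intro exI[of _ "2 ^ m"]) linarith
qed

section \<open>The finite extension argument\<close>

definition agree :: "nat \<Rightarrow> language \<Rightarrow> language \<Rightarrow> bool" where
  "agree l A B \<longleftrightarrow> (\<forall>w. length w \<le> l \<longrightarrow> (w \<in> A \<longleftrightarrow> w \<in> B))"

lemma unsolvable_dense:
  assumes "wf_otm M" "deterministic M"
  shows "\<exists>A' l'. l < l' \<and> agree l A A' \<and> (\<forall>A''. agree l' A' A'' \<longrightarrow> (\<exists>n. \<not> solves M p (coded A'') n))"
proof -
  \<comment> \<open>The polynomial is the counting condition of \<open>exists_hard_level\<close>. By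
    \<open>n \<ge> l\<close> the words of the level are longer than \<open>l\<close>, so earlier
    commitments remain intact.\<close>
  obtain n where n: "n \<ge> l" "poly (((p + 1) ^ 3 + 1) * (p + 1)) n < 2 ^ n"
    using poly_below_two_power by blast
  then have "((poly p n + 1) ^ 3 + 1) * (poly p n + 1) < 2 ^ n" by (simp add: poly_power)
  then obtain B where B: "B \<subseteq> block_level n" "\<not> solves M p (coded (A - block_level n \<union> B)) n"
    using exists_hard_level[OF assms] by blast
  define A' where "A' = A - block_level n \<union> B"
  \<comment> \<open>The new commitment covers all queries within the clock and all words of the
    level.\<close>
  define l' where "l' = poly p n + Suc (2 * n)"
  have "length w = Suc (2 * n)" if "w \<in> block_level n" for w
    using that by (auto simp: block_level_def length_block_word)
  then have "w \<notin> block_level n" if "length w \<le> l" for w using that n(1) by fastforce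
  then have "agree l A A'" using B(1) unfolding agree_def A'_def by blast
  moreover have "\<not> solves M p (coded A'') n" if "agree l' A' A''" for A''
  proof
    assume "solves M p (coded A'') n"
    then have "solves M p (coded A') n"
      by (rule solves_cong[OF assms(1), of l', rotated 3])
        (use that coded_cong[of l' A' A''] in \<open>auto simp: l'_def agree_def\<close>)
    then show False using B(2) by (simp add: A'_def)
  qed
  moreover have "l < l'" using n(1) by (simp add: l'_def)
  ultimately show ?thesis by blast
qed

text \<open>Stage \<open>Suc i\<close> commits to enough words to make \<open>program i\<close>, if
  deterministic, fail for every set respecting the commitment; the limit respects all
  commitments.\<close>

lemma exists_unsolvable:
  "\<exists>A. \<forall>M p. wf_otm M \<longrightarrow> deterministic M \<longrightarrow> (\<exists>n. \<not> solves M p (coded A) n)"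
proof -
  define good where "good i A l \<longleftrightarrow> (case program i of (M, p, s) \<Rightarrow>
      wf_otm M \<longrightarrow> deterministic M \<longrightarrow> (\<forall>A'. agree l A A' \<longrightarrow> (\<exists>n. \<not> solves M p (coded A') n)))" for i A l
  have "\<exists>z'. snd z < snd z' \<and> agree (snd z) (fst z) (fst z') \<and> good i (fst z') (snd z')"
    for i and z :: "language \<times> nat"
  proof -
    obtain M p s where i: "program i = (M, p, s)" by (cases "program i")
    show ?thesis
    proof (cases "wf_otm M \<and> deterministic M")
      case True
      then obtain A' l' where "snd z < l'" "agree (snd z) (fst z) A'"
          "\<forall>A''. agree l' A' A'' \<longrightarrow> (\<exists>n. \<not> solves M p (coded A'') n)"
        using unsolvable_dense by blast
      then show ?thesis by (intro exI[of _ "(A', l')"]) (simp add: good_def i)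
    next
      case False
      then show ?thesis by (intro exI[of _ "(fst z, Suc (snd z))"]) (auto simp: good_def i agree_def)
    qed
  qed
  then have "\<exists>f. \<forall>i. True \<and> (snd (f i) < snd (f (Suc i)) \<and> agree (snd (f i)) (fst (f i)) (fst (f (Suc i))) \<and>
      good i (fst (f (Suc i))) (snd (f (Suc i))))"
    by (intro dependent_nat_choice) auto
  then obtain f :: "nat \<Rightarrow> language \<times> nat" where
    f: "\<And>i. snd (f i) < snd (f (Suc i))" "\<And>i. agree (snd (f i)) (fst (f i)) (fst (f (Suc i)))"
       "\<And>i. good i (fst (f (Suc i))) (snd (f (Suc i)))" by auto
  define A where "A = {w. w \<in> fst (f (length w))}"
  have mono: "snd (f i) \<le> snd (f k)" if "i \<le> k" for i k
    by (rule lift_Suc_mono_le[of "\<lambda>i. snd (f i)", OF less_imp_le[OF f(1)] that])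
  \<comment> \<open>Commitments grow without bound, so stage \<open>length w\<close> already decides
    \<open>w\<close>; this justifies the definition of \<open>A\<close>.\<close>
  have ge: "i \<le> snd (f i)" for i
  proof (induction i)
    case (Suc i)
    then show ?case using f(1)[of i] by linarith
  qed simp
  have ag: "agree (snd (f i)) (fst (f i)) (fst (f k))" if "i \<le> k" for i k
    using that
  proof (induction k rule: dec_induct)
    case (step k)
    then show ?case using f(2)[of k] mono[of i k] unfolding agree_def by fastforce
  qed (simp add: agree_def)
  have agA: "agree (snd (f i)) (fst (f i)) A" for i
    unfolding agree_def
  proof (intro allI impI)
    fix w :: "bool list" assume w: "length w \<le> snd (f i)"
    show "w \<in> fst (f i) \<longleftrightarrow> w \<in> A"
    proof (cases "i \<le> length w")
      case True
      then show ?thesis using ag[OF True] w unfolding agree_def A_def by blast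
    next
      case False
      then show ?thesis using ag[of "length w" i] ge[of "length w"] unfolding agree_def A_def by auto
    qed
  qed
  have "\<exists>n. \<not> solves M p (coded A) n" if M: "wf_otm M" "deterministic M" for M p
  proof -
    \<comment> \<open>\<open>Blank\<close> is a default value for the letter; the stage concerns
      \<open>M\<close> with clock \<open>p\<close>.\<close>
    obtain i where "program i = (M, p, Blank)" using program_surj[OF M(1)] by blast
    then show ?thesis using f(3)[of i] agA[of "Suc i"] M by (auto simp: good_def)
  qed
  then show ?thesis by blast
qed

section \<open>The separating function\<close>

definition block_function :: "language \<Rightarrow> symbol list \<rightharpoonup> nat" where
  "block_function D x =
     (if x \<in> lists (range Bit) then Some (card (accepting_paths guesser D x)) else None)"

lemma lists_range_Bit: "x \<in> lists (range Bit) \<longleftrightarrow> (\<exists>y. x = map Bit y)"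
  by (auto simp: lists_image)

lemma block_function_sharpP: "block_function D \<in> sharpP D"
proof -
  have "poly_time guesser D (range Bit)"
    unfolding poly_time_def
  proof (intro exI ballI allI impI)
    fix x t c assume "x \<in> lists (range Bit)" and t: "(step guesser D ^^ t) (init guesser x) c"
    then obtain y where y: "x = map Bit y" using lists_range_Bit by blast
    have "t \<le> 2 * length y + 3" using guesser_time_init t unfolding time_bounded_def y by blast
    then show "t \<le> poly [:3, 2:] (length x)" by (simp add: y)
  qed
  then have "block_function D \<in> sharpP_over (range Bit) D"
    unfolding sharpP_over_def using wf_guesser by (auto simp: block_function_def dom_def)
  moreover have "input_alphabet (range Bit)" by (auto simp: input_alphabet_def)
  ultimately show ?thesis unfolding sharpP_def by blast
qed

lemma block_function_FP:
  assumes "block_function D \<in> FP D"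
  shows "\<exists>M p. wf_otm M \<and> deterministic M \<and> (\<forall>n. solves M p D n)"
proof -
  obtain S M where S: "dom (block_function D) = lists S" and M: "wf_otm M" "deterministic M"
    and pt: "poly_time M D S"
    and out: "\<And>x. x \<in> lists S \<Longrightarrow> \<exists>n. block_function D x = Some n \<and> outputs M D x n"
    using assms unfolding FP_def FP_over_def by blast
  \<comment> \<open>The alphabet \<open>S\<close> of the transducer is known only through the common
    domain, which contains all binary inputs.\<close>
  have w: "map Bit x \<in> lists S" for x
    unfolding S[symmetric] block_function_def dom_def using lists_range_Bit by auto
  obtain p where p: "\<And>x t c. x \<in> lists S \<Longrightarrow> (step M D ^^ t) (init M x) c \<Longrightarrow> t \<le> poly p (length x)"
    using pt unfolding poly_time_def by blast
  have "solves M p D n" for n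
    unfolding solves_def
  proof (intro allI impI conjI)
    fix x :: "bool list" assume x: "length x = n"
    show "time_bounded M D (init M (map Bit x)) (poly p n)"
      unfolding time_bounded_def using p[OF w] x by fastforce
    have "block_function D (map Bit x) = Some (block_count D x)"
      using lists_range_Bit by (auto simp: block_function_def guesser_accepting_paths)
    then show "outputs M D (map Bit x) (block_count D x)" using out[OF w[of x]] by auto
  qed
  then show ?thesis using M by blast
qed

theorem theorem5p1:
  shows "\<exists>D :: language. sharpP1 D \<subseteq> FP D \<and> FP D \<noteq> sharpP D"
proof -
  obtain A where "\<forall>M p. wf_otm M \<longrightarrow> deterministic M \<longrightarrow> (\<exists>n. \<not> solves M p (coded A) n)"
    using exists_unsolvable by blast
  then have "block_function (coded A) \<notin> FP (coded A)" using block_function_FP by blast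
  then have "FP (coded A) \<noteq> sharpP (coded A)" using block_function_sharpP by blast
  then show ?thesis using sharpP1_coded_subset by blast
qed

end
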